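(* Let $d\ge3$, $W=\mathbb{R}^{d+1}$, $D=\binom{d+1}{2}$, and let $G=(V,E)$ be a finite graph (parallel edges allowed, no loops) with a bipartition $\{B,R\}$ of $V$. Then for almost all rod-configurations $\mathbf{r}:R\to Gr(d-1,W)$, $$\mathrm{rank}(\overline{\mathcal{A}(\mathbf{r})})=\min\Big\{\sum_{i=1}^k\big(D|V(E_i)|-D-|R(E_i)|\big)\Big\},$$ where the minimum is over all partitions $\{E_1,\dots,E_k\}$ of $E$ into nonempty subsets. In other words, the linear polymatroid on $E$ with rank function $F\mapsto\mathrm{rank}(\overline{\mathcal{A}_F(\mathbf{r})})$ equals the polymatroid $(E,\hat f)$.
   Context: $V(F)$ is the set of vertices incident to edges of $F$; $R(F)=R\cap V(F)$; $f(F)=D(|V(F)|-1)-|R(F)|$ and $\hat f(F)=\min\sum_i f(F_i)$ over partitions of $F$ into nonempty parts ($\hat f(\emptyset)=0$). $\bigwedge^kW$ is identified with $\mathbb{R}^{\binom{d+1}{k}}$ via the standard basis; $Gr(d-1,W)\subseteq\mathbb{P}(\bigwedge^{d-1}W)$ via the Plücker embedding; a rod-configuration $\mathbf{r}$, $v\mapsto[\mathbf{r}_v]$, has distinct rods. For $\mathbf{p}\in\bigwedge^2W$, $\mathbf{s}\in\bigwedge^{d-1}W$, define $\mathbf{p}\cdot\mathbf{s}$ by $\mathbf{p}\wedge\mathbf{s}=(\mathbf{p}\cdot\mathbf{s})e_1\wedge\dots\wedge e_{d+1}$. Let $V_V=(\mathbb{R}^D)^V$, each block being $\bigwedge^2W$.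 For $v\in R$, $H_{\mathbf{r}}(v)=\{[\mathbf{p}]\in\mathbb{P}(\bigwedge^2W):\mathbf{p}\cdot\mathbf{r}_v=0\}$; for $v\in B$, $H_{\mathbf{r}}(v)=\mathbb{P}(\bigwedge^2W)$. For $e=uv$, $A_e(\mathbf{r})\subseteq\mathbb{P}(V_V)$ is the flat of points with $u$-block $\boldsymbol\alpha$, $v$-block $-\boldsymbol\alpha$, other blocks $0$, $[\boldsymbol\alpha]\in H_{\mathbf{r}}(u)\cap H_{\mathbf{r}}(v)$. $\mathcal{A}(\mathbf{r})=\{A_e(\mathbf{r}):e\in E\}$ and $\mathcal{A}_F(\mathbf{r})=\{A_e(\mathbf{r}):e\in F\}$. The overline denotes projective span; the rank of a flat is the dimension of its associated linear subspace. *)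

theory Defs
  imports "HOL-Analysis.Analysis" "HOL-Library.Disjoint_Sets" "HOL-Library.FuncSet"
begin

section \<open>Exterior algebra of the space of real vectors\<close>

text \<open>
  The ambient space is \<open>W = real ^ 'n\<close>; the linear order on \<open>'n\<close> orders the standard basis.
  The exterior algebra of \<open>W\<close> is \<open>real ^ ('n set)\<close>: the coordinate at
  \<open>S = {i\<^sub>1 < \<dots> < i\<^sub>k}\<close> is the coefficient of \<open>e\<^sub>i\<^sub>1 \<and> \<dots> \<and> e\<^sub>i\<^sub>k\<close>.
\<close>

type_synonym 'n ext = "(real, 'n set) vec"

definition ext_power :: "nat \<Rightarrow> ('n::{finite,linorder}) ext set" where
  "ext_power k = {p. \<forall>S. card S \<noteq> k \<longrightarrow> p $ S = 0}"

text \<open>The sign of the permutation that sorts the elements of \<open>S\<close> followed by those of \<open>T\<close>.\<close>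

definition shuffle_sign :: "('n::{finite,linorder}) set \<Rightarrow> 'n set \<Rightarrow> real" where
  "shuffle_sign S T = (- 1) ^ card {(i, j). i \<in> S \<and> j \<in> T \<and> j < i}"

definition wedge :: "('n::{finite,linorder}) ext \<Rightarrow> 'n ext \<Rightarrow> 'n ext" where
  "wedge p q = (\<chi> S. \<Sum>T\<in>Pow S. shuffle_sign T (S - T) * p $ T * q $ (S - T))"

definition ext_of_vec :: "real ^ ('n::{finite,linorder}) \<Rightarrow> 'n ext" where
  "ext_of_vec x = (\<Sum>i\<in>UNIV. axis {i} (x $ i))"

definition wedge_list :: "(real ^ ('n::{finite,linorder})) list \<Rightarrow> 'n ext" where
  "wedge_list xs = foldr (\<lambda>x. wedge (ext_of_vec x)) xs (axis {} 1)"

text \<open>The pairing of the exterior powers of degrees \<open>2\<close> and \<open>d - 1\<close>: the coefficient of the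
  product at \<open>e\<^sub>1 \<and> \<dots> \<and> e\<^sub>d\<^sub>+\<^sub>1\<close>.\<close>

definition ext_pairing :: "('n::{finite,linorder}) ext \<Rightarrow> 'n ext \<Rightarrow> real" where
  "ext_pairing p s = wedge p s $ UNIV"

section \<open>Projective spaces\<close>

text \<open>A projective point is the line through a nonzero vector; flats are sets of points.\<close>

definition proj_point :: "'a::real_vector \<Rightarrow> 'a set" where
  "proj_point x = span {x}"

definition proj_space :: "'a::real_vector set \<Rightarrow> 'a set set" where
  "proj_space U = proj_point ` (U - {0})"

definition proj_span :: "'a::real_vector set set \<Rightarrow> 'a set set" where
  "proj_span X = proj_space (span (\<Union>X))"

definition flat_subspace :: "'a::real_vector set set \<Rightarrow> 'a set" where
  "flat_subspace X = insert 0 (\<Union>X)"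

definition flat_rank :: "'a::real_vector set set \<Rightarrow> nat" where
  "flat_rank X = dim (flat_subspace X)"

section \<open>Rod-configurations\<close>

text \<open>The Grassmannian of \<open>k\<close>-dimensional subspaces of \<open>W\<close>, as its image under the
  Pluecker embedding.\<close>

definition Grassmannian :: "nat \<Rightarrow> ('n::{finite,linorder}) ext set set" where
  "Grassmannian k =
     {proj_point (wedge_list xs) | xs. length xs = k \<and> distinct xs \<and> independent (set xs)}"

definition rod_configuration ::
  "nat \<Rightarrow> 'v set \<Rightarrow> ('v \<Rightarrow> ('n::{finite,linorder}) ext set) \<Rightarrow> bool" where
  "rod_configuration d R r \<longleftrightarrow> r \<in> R \<rightarrow>\<^sub>E Grassmannian (d - 1) \<and> inj_on r R"

text \<open>The family of rods in which the rod of \<open>v\<close> is spanned by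
  \<open>x (v, 0), \<dots>, x (v, d - 2)\<close>.\<close>

definition spanned_rods ::
  "nat \<Rightarrow> 'v set \<Rightarrow> ('v \<times> nat \<Rightarrow> real ^ ('n::{finite,linorder})) \<Rightarrow> 'v \<Rightarrow> 'n ext set" where
  "spanned_rods d R x = (\<lambda>v\<in>R. proj_point (wedge_list (map (\<lambda>i. x (v, i)) [0..<d - 1])))"

text \<open>
  Sending a linearly independent \<open>(d - 1)\<close>-tuple of vectors to its span is a surjective submersion
  onto the Grassmannian, so a set of rod-configurations is null for the natural (smooth, or
  equivalently rotation invariant) measure class on the product of Grassmannians iff the set of
  families of spanning tuples it pulls back to is Lebesgue null. Tuples that do not define a
  rod-configuration are excluded by the premise under \<open>AE\<close>.
\<close>

definition almost_all_rod_configurations ::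
  "nat \<Rightarrow> 'v set \<Rightarrow> (('v \<Rightarrow> ('n::{finite,linorder}) ext set) \<Rightarrow> bool) \<Rightarrow> bool" where
  "almost_all_rod_configurations d R P \<longleftrightarrow>
     (AE x in (\<Pi>\<^sub>M j\<in>R \<times> {..<d - 1}. (lborel :: (real, 'n) vec measure)).
        rod_configuration d R (spanned_rods d R x) \<longrightarrow> P (spanned_rods d R x))"

section \<open>Graphs and the flats of a rod-configuration\<close>

text \<open>A loopless multigraph: \<open>ends e\<close> is the two-element set of end vertices of the edge \<open>e\<close>,
  and distinct edges may have the same ends.\<close>

definition multigraph :: "'v set \<Rightarrow> 'e set \<Rightarrow> ('e \<Rightarrow> 'v set) \<Rightarrow> bool" where
  "multigraph V E ends \<longleftrightarrow>
     finite V \<and> finite E \<and> (\<forall>e\<in>E. ends e \<subseteq> V \<and> card (ends e) = 2)"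

definition verts_of :: "('e \<Rightarrow> 'v set) \<Rightarrow> 'e set \<Rightarrow> 'v set" where
  "verts_of ends F = (\<Union>e\<in>F. ends e)"

definition rod_hyperplane ::
  "'v set \<Rightarrow> ('v \<Rightarrow> ('n::{finite,linorder}) ext set) \<Rightarrow> 'v \<Rightarrow> 'n ext set set" where
  "rod_hyperplane R r v =
     (if v \<in> R
      then {proj_point p | p. p \<in> ext_power 2 - {0} \<and> (\<forall>s\<in>r v. ext_pairing p s = 0)}
      else proj_space (ext_power 2))"

text \<open>The vertex type is finite; blocks at elements outside the vertex set of the graph are always
  \<open>0\<close>. Exchanging \<open>u\<close> and \<open>v\<close> below amounts to negating \<open>a\<close>, so the flat does not depend on an
  orientation of the edge.\<close>

definition edge_flat ::
  "'v set \<Rightarrow> ('e \<Rightarrow> 'v set) \<Rightarrow> ('v::finite \<Rightarrow> ('n::{finite,linorder}) ext set) \<Rightarrow> 'e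
     \<Rightarrow> ('n ext ^ 'v) set set" where
  "edge_flat R ends r e =
     {proj_point (\<chi> w. if w = u then a else if w = v then - a else 0) | u v a.
        ends e = {u, v} \<and> u \<noteq> v \<and>
        proj_point a \<in> rod_hyperplane R r u \<inter> rod_hyperplane R r v}"

definition edge_flats ::
  "'v set \<Rightarrow> ('e \<Rightarrow> 'v set) \<Rightarrow> ('v::finite \<Rightarrow> ('n::{finite,linorder}) ext set) \<Rightarrow> 'e set
     \<Rightarrow> ('n ext ^ 'v) set set set" where
  "edge_flats R ends r F = edge_flat R ends r ` F"

section \<open>The polymatroid of counts\<close>

definition count_f :: "nat \<Rightarrow> 'v set \<Rightarrow> ('e \<Rightarrow> 'v set) \<Rightarrow> 'e set \<Rightarrow> int" where
  "count_f d R ends F =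
     int ((d + 1) choose 2) * (int (card (verts_of ends F)) - 1)
       - int (card (R \<inter> verts_of ends F))"

text \<open>The only partition of the empty set is the empty one, so the value there is \<open>0\<close>.\<close>

definition count_f_hat :: "nat \<Rightarrow> 'v set \<Rightarrow> ('e \<Rightarrow> 'v set) \<Rightarrow> 'e set \<Rightarrow> int" where
  "count_f_hat d R ends F = Min {(\<Sum>X\<in>P. count_f d R ends X) | P. partition_on F P}"

end

theory Submission imports Defs begin

text \<open>
  Dually, the rod of \<open>v\<close> becomes a bivector \<open>q v\<close> (put \<open>q v = 0\<close> for a body), and a vector orthogonal
  to all flats \<open>A\<^sub>e\<close> is a family of lines \<open>m v + span {q v}\<close> such that the lines of adjacent vertices
  meet. We work with hyperedges, a hyperedge \<open>h\<close> forcing all lines of \<open>h\<close> through one point \<open>w h\<close>. If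
  \<open>w h = w h'\<close> for all motions, then \<open>h\<close> and \<open>h'\<close> can be merged without changing the span; this
  builds the minimizing partition. Otherwise any linear relation between the
  flats has the following support: every rod lies in at least three hyperedges (two are impossible,
  because a generic \<open>q u\<close> lies in no proper subspace determined by the other rods), every hyperedge
  has at least two rods, and after removal of one hyperedge there is, by induction, no relation
  left. Counting incidences shows that this is impossible as soon as \<open>D \<ge> 4\<close>. Of the
  Grassmannian one only uses that its Pluecker vectors span the exterior power and that the zero set
  of a nonzero multilinear function is null.
\<close>

section \<open>Sums of subspaces\<close>

lemma sum_fun_upd_insert:
  assumes "finite I" "j \<notin> I"
  shows "sum (c(j := x)) (insert j I) = x + sum c I"
proof -
  have "sum (c(j := x)) I = sum c I" using assms(2) by (intro sum.cong) auto
  then show ?thesis using assms by simp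
qed

lemma span_UN_subspaces:
  fixes S :: "'i \<Rightarrow> 'a::real_vector set"
  assumes "finite I" "\<And>i. i \<in> I \<Longrightarrow> subspace (S i)"
  shows "span (\<Union>i\<in>I. S i) = {(\<Sum>i\<in>I. c i) | c. \<forall>i\<in>I. c i \<in> S i}"
  using assms
proof (induction I)
  case empty
  then show ?case by simp
next
  case (insert j I)
  have "span (\<Union>i\<in>insert j I. S i) = {x + y | x y. x \<in> span (S j) \<and> y \<in> span (\<Union>i\<in>I. S i)}"
    by (simp add: span_Un)
  also have "\<dots> = {x + y | x y. x \<in> S j \<and> (\<exists>c. y = (\<Sum>i\<in>I. c i) \<and> (\<forall>i\<in>I. c i \<in> S i))}"
    using insert by (simp add: span_eq_iff[THEN iffD2])
  also have "\<dots> = {(\<Sum>i\<in>insert j I. c i) | c. \<forall>i\<in>insert j I. c i \<in> S i}" (is "?L = ?R")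
  proof
    show "?L \<subseteq> ?R"
    proof clarify
      fix x c assume x: "x \<in> S j" and c: "\<forall>i\<in>I. c i \<in> S i"
      have "sum (c(j := x)) (insert j I) = x + sum c I"
        using insert(1,2) by (rule sum_fun_upd_insert)
      with x c show "\<exists>c'. x + sum c I = sum c' (insert j I) \<and> (\<forall>i\<in>insert j I. c' i \<in> S i)"
        by (intro exI[of _ "c(j := x)"]) auto
    qed
    show "?R \<subseteq> ?L" using insert(1,2) by auto
  qed
  finally show ?case .
qed

lemma dim_direct_sum:
  fixes S :: "'i \<Rightarrow> 'a::euclidean_space set"
  assumes "finite I" "\<And>i. i \<in> I \<Longrightarrow> subspace (S i)"
    and "\<And>c. \<forall>i\<in>I. c i \<in> S i \<Longrightarrow> (\<Sum>i\<in>I. c i) = 0 \<Longrightarrow> \<forall>i\<in>I. c i = 0"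
  shows "dim (span (\<Union>i\<in>I. S i)) = (\<Sum>i\<in>I. dim (S i))"
  using assms
proof (induction I)
  case empty
  then show ?case by simp
next
  case (insert j I)
  let ?T = "span (\<Union>i\<in>I. S i)"
  have IH: "dim ?T = (\<Sum>i\<in>I. dim (S i))"
  proof (rule insert.IH)
    fix c assume c: "\<forall>i\<in>I. c i \<in> S i" "sum c I = 0"
    have "sum (c(j := 0)) (insert j I) = 0"
      unfolding sum_fun_upd_insert[OF insert(1,2)] using c(2) by simp
    moreover have "\<forall>i\<in>insert j I. (c(j := 0)) i \<in> S i"
      using c(1) insert(4) by (auto intro: subspace_0)
    ultimately have "\<forall>i\<in>insert j I. (c(j := 0)) i = 0" using insert.prems(2) by blast
    then show "\<forall>i\<in>I. c i = 0" using insert(2) by (metis fun_upd_other insertCI)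
  qed (use insert in auto)
  have "S j \<inter> ?T \<subseteq> {0}"
  proof
    fix x assume x: "x \<in> S j \<inter> ?T"
    then obtain c where c: "x = sum c I" "\<forall>i\<in>I. c i \<in> S i"
      using span_UN_subspaces[of I S] insert by auto
    have "sum (c(j := - x)) (insert j I) = 0"
      unfolding sum_fun_upd_insert[OF insert(1,2)] using c(1) by simp
    moreover have "\<forall>i\<in>insert j I. (c(j := - x)) i \<in> S i"
      using c(2) x insert(4) by (auto intro: subspace_neg)
    ultimately have "\<forall>i\<in>insert j I. (c(j := - x)) i = 0" using insert.prems(2) by blast
    then show "x \<in> {0}" by (metis fun_upd_same insertCI neg_equal_0_iff_equal singletonI)
  qed
  then have "dim (S j \<inter> ?T) = 0" by simp
  moreover have "span (\<Union>i\<in>insert j I. S i) = {x + y | x y. x \<in> S j \<and> y \<in> ?T}"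
    using insert by (simp add: span_Un span_eq_iff[THEN iffD2])
  moreover have "dim {x + y | x y. x \<in> S j \<and> y \<in> ?T} + dim (S j \<inter> ?T) = dim (S j) + dim ?T"
    using insert by (intro dim_sums_Int) auto
  ultimately show ?case using IH insert(1,2) by (simp del: dim_eq_0)
qed

lemma dim_sum_le:
  fixes S :: "'i \<Rightarrow> 'a::euclidean_space set"
  assumes "finite I"
  shows "dim (span (\<Union>i\<in>I. S i)) \<le> (\<Sum>i\<in>I. dim (S i))"
  using assms
proof (induction I)
  case (insert j I)
  let ?T = "span (\<Union>i\<in>I. S i)"
  have "span (\<Union>i\<in>insert j I. S i) = {x + y | x y. x \<in> span (S j) \<and> y \<in> ?T}"
    by (simp add: span_Un)
  moreover have "dim {x + y | x y. x \<in> span (S j) \<and> y \<in> ?T} + dim (span (S j) \<inter> ?T) = dim (span (S j)) + dim ?T"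
    by (intro dim_sums_Int) auto
  ultimately show ?case using insert by simp
qed simp

lemma linear_axis: "linear (axis v :: 'a::real_vector \<Rightarrow> 'a ^ 'v::finite)"
  by (rule linearI) (auto simp: vec_eq_iff axis_def)

lemma dim_vec_blocks:
  fixes S :: "'v::finite \<Rightarrow> 'a::euclidean_space set"
  assumes "\<And>v. subspace (S v)"
  shows "dim {x::'a^'v. \<forall>v. x $ v \<in> S v} = (\<Sum>v\<in>UNIV. dim (S v))"
proof -
  let ?B = "\<lambda>v. axis v ` S v"
  have sub: "subspace (?B v)" for v
    by (rule linear_subspace_image[OF linear_axis assms])
  have eq: "x = (\<Sum>v\<in>UNIV. axis v (x $ v))" for x :: "'a^'v"
    by (simp add: vec_eq_iff axis_def)
  have "span (\<Union>v\<in>UNIV. ?B v) = {x. \<forall>v. x $ v \<in> S v}"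
  proof (subst span_UN_subspaces[OF _ sub], simp, safe)
    fix c w assume "\<forall>i\<in>UNIV. c i \<in> axis i ` S i"
    then have "\<forall>i. \<exists>s. s \<in> S i \<and> c i = axis i s" by blast
    then obtain s where s: "\<And>i. s i \<in> S i" "\<And>i. c i = axis i (s i)" by metis
    have "(\<Sum>i\<in>UNIV. c i) $ w = s w" unfolding s(2) by (simp add: axis_def)
    with s show "(\<Sum>i\<in>UNIV. c i) $ w \<in> S w" by simp
  next
    fix x :: "'a^'v" assume "\<forall>v. x $ v \<in> S v"
    then show "\<exists>c. x = sum c UNIV \<and> (\<forall>i\<in>UNIV. c i \<in> axis i ` S i)"
      using eq[of x] by (intro exI[of _ "\<lambda>v. axis v (x $ v)"]) auto
  qed
  moreover have "dim (span (\<Union>v\<in>UNIV. ?B v)) = (\<Sum>v\<in>UNIV. dim (?B v))"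
  proof (rule dim_direct_sum[OF _ sub], simp, safe)
    fix c :: "'v \<Rightarrow> 'a^'v" and i assume "\<forall>i\<in>UNIV. c i \<in> axis i ` S i" and 0: "sum c UNIV = 0"
    then have "\<forall>i. \<exists>s. s \<in> S i \<and> c i = axis i s" by blast
    then obtain s where s: "\<And>i. s i \<in> S i" "\<And>i. c i = axis i (s i)" by metis
    have "(\<Sum>i\<in>UNIV. c i) $ w = s w" for w unfolding s(2) by (simp add: axis_def)
    then have "s i = 0" using 0 by simp
    then show "c i = 0" using s(2) by (simp add: axis_def vec_eq_iff)
  qed
  moreover have "dim (?B v) = dim (S v)" for v
    by (rule dim_image_eq[OF linear_axis]) (auto simp: inj_on_def axis_eq_axis)
  ultimately show ?thesis by simp
qed

section \<open>Stresses and concurrent lines\<close>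

text \<open>The incidences at \<open>u\<close> are dropped, so that the gaps do not depend on \<open>q u\<close>.\<close>

definition gaps :: "'a::euclidean_space set \<Rightarrow> ('v \<Rightarrow> 'a) \<Rightarrow> 'v \<Rightarrow> 'v set set \<Rightarrow> 'v set \<Rightarrow> 'v set \<Rightarrow> 'a set" where
  "gaps U q u H h h' =
     {w h - w h' | m w. \<forall>k\<in>H. w k \<in> U \<and> (\<forall>v\<in>k - {u}. m v - w k \<in> span {q v})}"

lemma subspace_gaps:
  assumes subspace_U: "subspace U"
  shows "subspace (gaps U q u H h h')"
proof (rule subspaceI)
  show "0 \<in> gaps U q u H h h'" unfolding gaps_def
    by (rule CollectI, rule exI[of _ "\<lambda>_. 0"], rule exI[of _ "\<lambda>_. 0"])
      (use subspace_U in \<open>auto simp: subspace_0 span_0\<close>)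
next
  fix x y assume "x \<in> gaps U q u H h h'" "y \<in> gaps U q u H h h'"
  then obtain m w m' w' where xy: "x = w h - w h'" "y = w' h - w' h'"
    and 1: "\<forall>k\<in>H. w k \<in> U \<and> (\<forall>v\<in>k - {u}. m v - w k \<in> span {q v})"
    and 2: "\<forall>k\<in>H. w' k \<in> U \<and> (\<forall>v\<in>k - {u}. m' v - w' k \<in> span {q v})"
    unfolding gaps_def by auto
  show "x + y \<in> gaps U q u H h h'" unfolding gaps_def
  proof (rule CollectI, rule exI[of _ "\<lambda>v. m v + m' v"], rule exI[of _ "\<lambda>k. w k + w' k"], intro conjI ballI)
    fix k assume k: "k \<in> H"
    then show "w k + w' k \<in> U" using 1 2 subspace_U by (simp add: subspace_add)
    fix v assume "v \<in> k - {u}"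
    then have "m v - w k \<in> span {q v}" "m' v - w' k \<in> span {q v}" using 1 2 k by auto
    from span_add[OF this] show "m v + m' v - (w k + w' k) \<in> span {q v}" by (simp add: algebra_simps)
  qed (simp add: xy)
next
  fix c x assume "x \<in> gaps U q u H h h'"
  then obtain m w where x: "x = w h - w h'"
    and 1: "\<forall>k\<in>H. w k \<in> U \<and> (\<forall>v\<in>k - {u}. m v - w k \<in> span {q v})"
    unfolding gaps_def by auto
  show "c *\<^sub>R x \<in> gaps U q u H h h'" unfolding gaps_def
  proof (rule CollectI, rule exI[of _ "\<lambda>v. c *\<^sub>R m v"], rule exI[of _ "\<lambda>k. c *\<^sub>R w k"], intro conjI ballI)
    fix k assume k: "k \<in> H"
    then show "c *\<^sub>R w k \<in> U" using 1 subspace_U by (simp add: subspace_scale)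
    fix v assume "v \<in> k - {u}"
    then have "m v - w k \<in> span {q v}" using 1 k by auto
    from span_scale[OF this, of c] show "c *\<^sub>R m v - c *\<^sub>R w k \<in> span {q v}" by (simp add: scaleR_diff_right)
  qed (simp add: x scaleR_diff_right)
qed

locale generic_directions =
  fixes U :: "'a::euclidean_space set" and R :: "'v::finite set" and q :: "'v \<Rightarrow> 'a"
  assumes subspace_U: "subspace U" and q_in_U: "q v \<in> U" and q_body: "v \<notin> R \<Longrightarrow> q v = 0"
    and dim_U: "4 \<le> dim U"
    and generic: "\<lbrakk>u \<in> R; h \<in> H; h' \<in> H; q u \<in> gaps U q u H h h'\<rbrakk> \<Longrightarrow> U \<subseteq> gaps U q u H h h'"
begin

lemma q_notin_span:
  assumes "u \<in> R" "v \<noteq> u"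
  shows "q u \<notin> span {q v}"
proof
  assume *: "q u \<in> span {q v}"
  \<comment> \<open>for these hyperedges all gaps are multiples of \<open>q v\<close>\<close>
  let ?H = "{{u, v}, {v}}"
  have ne: "{u, v} \<noteq> {v}" using assms by auto
  have "q u \<in> gaps U q u ?H {u, v} {v}"
    unfolding gaps_def
  proof (intro CollectI exI conjI)
    let ?w = "\<lambda>k. if k = {u, v} then q u else 0"
    show "q u = ?w {u, v} - ?w {v}" using ne by simp
    show "\<forall>k\<in>?H. ?w k \<in> U \<and> (\<forall>v\<in>k - {u}. 0 - ?w k \<in> span {q v})"
      using * ne q_in_U subspace_U by (auto simp: span_neg subspace_0 span_0)
  qed
  then have "U \<subseteq> gaps U q u ?H {u, v} {v}" by (intro generic) (use assms in auto)
  also have "\<dots> \<subseteq> span {q v}"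
  proof
    fix x assume "x \<in> gaps U q u ?H {u, v} {v}"
    then obtain m w where x: "x = w {u, v} - w {v}"
      and "\<forall>k\<in>?H. w k \<in> U \<and> (\<forall>v\<in>k - {u}. m v - w k \<in> span {q v})"
      unfolding gaps_def by blast
    then have "m v - w {v} \<in> span {q v}" "m v - w {u, v} \<in> span {q v}" using assms(2) by auto
    then show "x \<in> span {q v}" using span_diff[of "m v - w {v}" _ "m v - w {u, v}"] by (simp add: x)
  qed
  finally have "dim U \<le> dim {q v}" by (metis dim_mono)
  also have "\<dots> \<le> card {q v}" by (rule dim_le_card') simp
  finally show False using dim_U by simp
qed

lemma span_q_Int:
  assumes "u \<noteq> v" "x \<in> span {q u}" "x \<in> span {q v}"
  shows "x = 0"
proof (rule ccontr)
  assume "x \<noteq> 0"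
  obtain a where a: "x = a *\<^sub>R q u" using assms(2) by (auto simp: span_singleton)
  with \<open>x \<noteq> 0\<close> have "u \<in> R" using q_body by force
  have "q u = (1 / a) *\<^sub>R x" using a \<open>x \<noteq> 0\<close> by simp
  then have "q u \<in> span {q v}" using assms(3) by (metis span_mul)
  then show False using q_notin_span[OF \<open>u \<in> R\<close>, of v] assms(1) by blast
qed

lemma two_elements:
  assumes "2 \<le> card h"
  obtains u v where "u \<in> h" "v \<in> h" "u \<noteq> v"
  using assms by (metis One_nat_def card_le_Suc0_iff_eq card.infinite not_less_eq_eq numeral_2_eq_2 zero_le)

definition blocks :: "('a ^ 'v) set" where
  "blocks = {x. \<forall>v. x $ v \<in> U}"

definition stresses :: "'v set \<Rightarrow> ('a ^ 'v) set" where
  "stresses h = {x \<in> blocks. (\<forall>v. v \<notin> h \<longrightarrow> x $ v = 0) \<and> (\<Sum>v\<in>UNIV. x $ v) = 0 \<and> (\<forall>v. x $ v \<bullet> q v = 0)}"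

definition concurrent :: "'v set \<Rightarrow> ('v \<Rightarrow> 'a) \<Rightarrow> 'a \<Rightarrow> bool" where
  "concurrent h m w \<longleftrightarrow> w \<in> U \<and> (\<forall>v\<in>h. m v - w \<in> span {q v})"

definition sparsity :: "'v set \<Rightarrow> int" where
  "sparsity h = int (dim U) * (int (card h) - 1) - int (card (R \<inter> h))"

lemma subspace_blocks: "subspace blocks"
  using subspace_U by (auto simp: blocks_def subspace_def)

lemma subspace_stresses: "subspace (stresses h)"
  using subspace_blocks
  by (auto simp: stresses_def subspace_def sum.distrib inner_add_left simp flip: scaleR_sum_right)

lemma inner_span_q:
  assumes "x \<bullet> q v = 0" "y \<in> span {q v}"
  shows "x \<bullet> y = 0"
  using assms by (auto simp: span_singleton)

lemma concurrent_orthogonal: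
  assumes "x \<in> stresses h" "concurrent h (\<lambda>v. m $ v) w"
  shows "x \<bullet> m = 0"
proof -
  have "x $ v \<bullet> m $ v = x $ v \<bullet> w" for v
  proof (cases "v \<in> h")
    case True
    then have "x $ v \<bullet> q v = 0" "m $ v - w \<in> span {q v}"
      using assms by (auto simp: stresses_def concurrent_def)
    then have "x $ v \<bullet> (m $ v - w) = 0" by (rule inner_span_q)
    then show ?thesis by (simp add: inner_diff_right)
  next
    case False
    then show ?thesis using assms(1) by (simp add: stresses_def)
  qed
  then have "x \<bullet> m = (\<Sum>v\<in>UNIV. x $ v) \<bullet> w" by (simp add: inner_vec_def inner_sum_left)
  then show ?thesis using assms(1) by (simp add: stresses_def)
qed

definition concurrences :: "'v set \<Rightarrow> ('a ^ 'v) set" where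
  "concurrences h = {m \<in> blocks. \<exists>w. concurrent h (\<lambda>v. m $ v) w}"

lemma concurrences_eq_sums:
  "concurrences h = {x + y | x y. x \<in> (\<lambda>w. \<chi> v. w) ` U \<and>
      y \<in> {y. \<forall>v. y $ v \<in> (if v \<in> h then span {q v} else U)}}" (is "_ = ?S")
proof
  show "concurrences h \<subseteq> ?S"
  proof
    fix m assume "m \<in> concurrences h"
    then obtain w where m: "m \<in> blocks" and w: "concurrent h (\<lambda>v. m $ v) w"
      by (auto simp: concurrences_def)
    have "m = (\<chi> v. w) + (m - (\<chi> v. w))" by simp
    moreover have "(\<chi> v. w) \<in> (\<lambda>w. \<chi> v. w) ` U" using w by (auto simp: concurrent_def)
    moreover have "m - (\<chi> v. w) \<in> {y. \<forall>v. y $ v \<in> (if v \<in> h then span {q v} else U)}"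
      using w m subspace_U by (auto simp: concurrent_def blocks_def subspace_diff)
    ultimately show "m \<in> ?S" by blast
  qed
  show "?S \<subseteq> concurrences h"
  proof clarify
    fix w :: 'a and y :: "'a^'v"
    assume w: "w \<in> U" and y: "\<forall>v. y $ v \<in> (if v \<in> h then span {q v} else U)"
    have "span {q v} \<subseteq> U" for v using q_in_U subspace_U by (simp add: span_minimal)
    then have "y $ v \<in> U" for v using y by (metis subsetD)
    then have "(\<chi> v. w) + y \<in> blocks"
      using w subspace_U by (auto simp: blocks_def subspace_add)
    moreover have "concurrent h (\<lambda>v. ((\<chi> v. w) + y) $ v) w"
      unfolding concurrent_def
    proof (intro conjI ballI)
      fix v assume "v \<in> h"
      with y have "y $ v \<in> span {q v}" by (metis (full_types))
      then show "((\<chi> v. w) + y) $ v - w \<in> span {q v}" by simp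
    qed (rule w)
    ultimately show "(\<chi> v. w) + y \<in> concurrences h" unfolding concurrences_def by blast
  qed
qed

lemma linear_const: "linear (\<lambda>w::'a. (\<chi> v::'v. w))"
  by (rule linearI) (auto simp: vec_eq_iff)

lemma subspace_constants: "subspace ((\<lambda>w::'a. (\<chi> v::'v. w)) ` U)"
  by (rule linear_subspace_image[OF linear_const subspace_U])

lemma subspace_parallels: "subspace {y::'a^'v. \<forall>v. y $ v \<in> (if v \<in> h then span {q v} else U)}"
proof -
  define S where "S v = (if v \<in> h then span {q v} else U)" for v
  have "subspace (S v)" for v using subspace_U by (simp add: S_def)
  then have "subspace {y::'a^'v. \<forall>v. y $ v \<in> S v}" by (auto simp: subspace_def)
  then show ?thesis by (simp only: S_def)
qed

lemma subspace_concurrences: "subspace (concurrences h)"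
  unfolding concurrences_eq_sums by (rule subspace_sums[OF subspace_constants subspace_parallels])

lemma stresses_eq_orthogonal:
  "stresses h = {x \<in> blocks. \<forall>m\<in>concurrences h. orthogonal m x}"
proof (intro equalityI subsetI CollectI conjI ballI)
  fix x m assume "x \<in> stresses h" "m \<in> concurrences h"
  then show "orthogonal m x"
    using concurrent_orthogonal[of x h m] inner_commute[of m x]
    by (auto simp: concurrences_def orthogonal_def)
next
  fix x assume "x \<in> stresses h" then show "x \<in> blocks" by (simp add: stresses_def)
next
  fix x assume "x \<in> {x \<in> blocks. \<forall>m\<in>concurrences h. orthogonal m x}"
  then have x: "x \<in> blocks" and ort: "\<And>m. m \<in> concurrences h \<Longrightarrow> x \<bullet> m = 0"
    by (auto simp: orthogonal_def inner_commute)
  have axis_in: "axis v a \<in> concurrences h" if "a \<in> U" "v \<in> h \<Longrightarrow> a \<in> span {q v}" for v a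
  proof -
    have "axis v a \<in> blocks" using that subspace_U by (auto simp: blocks_def axis_def subspace_0)
    moreover have "concurrent h (\<lambda>x. axis v a $ x) 0"
      using that subspace_U by (auto simp: concurrent_def axis_def subspace_0 span_0)
    ultimately show ?thesis unfolding concurrences_def by blast
  qed
  have "x $ v = 0" if "v \<notin> h" for v
  proof -
    have "x $ v \<in> U" using x by (simp add: blocks_def)
    then have "x \<bullet> axis v (x $ v) = 0" using that by (intro ort axis_in) auto
    then show ?thesis by (simp add: inner_axis)
  qed
  moreover have "(\<Sum>v\<in>UNIV. x $ v) = 0"
  proof -
    let ?s = "\<Sum>v\<in>UNIV. x $ v"
    have s: "?s \<in> U" using x subspace_U by (intro subspace_sum) (auto simp: blocks_def)
    then have "(\<chi> v. ?s) \<in> blocks" by (simp add: blocks_def)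
    moreover have "concurrent h (\<lambda>v. (\<chi> v. ?s) $ v) ?s"
      using s by (auto simp: concurrent_def span_0)
    ultimately have "(\<chi> v. ?s) \<in> concurrences h" unfolding concurrences_def by blast
    then have "x \<bullet> (\<chi> v. ?s) = 0" by (rule ort)
    then have "?s \<bullet> ?s = 0" by (simp add: inner_vec_def inner_sum_left)
    then show ?thesis by simp
  qed
  moreover have "x $ v \<bullet> q v = 0" for v
  proof -
    have "x \<bullet> axis v (q v) = 0" by (intro ort axis_in q_in_U) (simp add: span_base)
    then show ?thesis by (simp add: inner_axis)
  qed
  ultimately show "x \<in> stresses h" using x by (simp add: stresses_def)
qed

lemma dim_stresses:
  assumes "2 \<le> card h"
  shows "int (dim (stresses h)) = sparsity h"
proof -
  have dim_span_q: "dim (span {q v}) = (if v \<in> R then 1 else 0)" for v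
  proof (cases "v \<in> R")
    case True
    obtain x y where "x \<in> h" "y \<in> h" "x \<noteq> y" using two_elements[OF assms] .
    then obtain u where "u \<noteq> v" by metis
    then have "q v \<noteq> 0" using q_notin_span[OF True] by (metis span_0)
    then show ?thesis using True by simp
  qed (simp add: q_body)
  have sub: "concurrences h \<subseteq> blocks" by (auto simp: concurrences_def)
  have 1: "dim (stresses h) + dim (concurrences h) = dim blocks"
    unfolding stresses_eq_orthogonal
    by (rule dim_subspace_orthogonal_to_vectors[OF subspace_concurrences subspace_blocks sub])
  have 2: "dim blocks = CARD('v) * dim U"
    unfolding blocks_def using dim_vec_blocks[of "\<lambda>_::'v. U"] subspace_U by simp
  let ?K = "(\<lambda>w::'a. (\<chi> v::'v. w)) ` U"
  let ?Q = "{y::'a^'v. \<forall>v. y $ v \<in> (if v \<in> h then span {q v} else U)}"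
  have "?K \<inter> ?Q \<subseteq> {0}"
  proof
    fix y assume y: "y \<in> ?K \<inter> ?Q"
    then obtain w where w: "y = (\<chi> v. w)" by blast
    obtain u v where uv: "u \<in> h" "v \<in> h" "u \<noteq> v" using two_elements[OF assms] .
    from y have "y $ u \<in> span {q u}" "y $ v \<in> span {q v}" using uv by (auto split: if_splits)
    then have "w = 0" using span_q_Int[OF uv(3)] by (simp add: w)
    then show "y \<in> {0}" by (simp add: w vec_eq_iff)
  qed
  then have "dim (?K \<inter> ?Q) = 0" by simp
  moreover have "dim (concurrences h) + dim (?K \<inter> ?Q) = dim ?K + dim ?Q"
    unfolding concurrences_eq_sums by (rule dim_sums_Int[OF subspace_constants subspace_parallels])
  moreover have "dim ?K = dim U"
    by (rule dim_image_eq[OF linear_const]) (auto simp: inj_on_def vec_eq_iff)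
  moreover have "dim ?Q = (\<Sum>v\<in>UNIV. dim (if v \<in> h then span {q v} else U))"
    using subspace_U by (intro dim_vec_blocks) simp
  moreover have "\<dots> = (\<Sum>v\<in>h. dim (span {q v})) + (\<Sum>v\<in>- h. dim U)"
  proof -
    have "(\<Sum>v\<in>UNIV. dim (if v \<in> h then span {q v} else U)) =
        (\<Sum>v\<in>h. dim (if v \<in> h then span {q v} else U)) + (\<Sum>v\<in>- h. dim (if v \<in> h then span {q v} else U))"
      by (metis (no_types, lifting) Compl_partition finite Compl_disjoint sum.union_disjoint)
    then show ?thesis by (simp cong: sum.cong_simp)
  qed
  moreover have "(\<Sum>v\<in>h. dim (span {q v})) = card (R \<inter> h)"
    unfolding dim_span_q by (simp add: sum.If_cases Int_commute)
  ultimately have 3: "dim (concurrences h) = dim U + card (R \<inter> h) + card (- h) * dim U"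
    by (simp del: dim_eq_0 dim_span)
  have "card (- h) + card h = CARD('v)"
    by (metis Compl_eq_Diff_UNIV card_Diff_subset card_mono finite le_add_diff_inverse2 subset_UNIV)
  then have "dim (stresses h) + (dim U + card (R \<inter> h) + card (- h) * dim U)
      = (card (- h) + card h) * dim U"
    using 1 2 3 by simp
  then have "dim (stresses h) + dim U + card (R \<inter> h) = card h * dim U"
    by (simp add: algebra_simps)
  then have "int (dim (stresses h)) + int (dim U) + int (card (R \<inter> h)) = int (card h) * int (dim U)"
    by (metis of_nat_add of_nat_mult)
  then show ?thesis by (simp add: sparsity_def algebra_simps)
qed

definition stress_span :: "'v set set \<Rightarrow> ('a ^ 'v) set" where
  "stress_span H = span (\<Union>h\<in>H. stresses h)"

definition separated :: "'v set set \<Rightarrow> bool" where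
  "separated H \<longleftrightarrow> (\<forall>h\<in>H. \<forall>h'\<in>H. h \<noteq> h' \<longrightarrow>
     (\<exists>m w. (\<forall>k\<in>H. concurrent k m (w k)) \<and> w h \<noteq> w h'))"

lemma stresses_mono: "h \<subseteq> h' \<Longrightarrow> stresses h \<subseteq> stresses h'"
  by (auto simp: stresses_def)

lemma stress_span_subset_blocks: "stress_span H \<subseteq> blocks"
  unfolding stress_span_def
  by (rule span_minimal[OF _ subspace_blocks]) (auto simp: stresses_def)

lemma concurrent_if_orthogonal:
  assumes "m \<in> blocks" "\<And>x. x \<in> stresses h \<Longrightarrow> x \<bullet> m = 0"
  shows "\<exists>w. concurrent h (\<lambda>v. m $ v) w"
proof -
  obtain y z where y: "y \<in> span (concurrences h)"
    and z: "\<And>x. x \<in> span (concurrences h) \<Longrightarrow> orthogonal z x" and m: "m = y + z"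
    using orthogonal_subspace_decomp_exists[of "concurrences h" m] by blast
  have y': "y \<in> concurrences h" using y subspace_concurrences by (simp add: span_eq_iff[THEN iffD2])
  then have "y \<in> blocks" by (simp add: concurrences_def)
  then have "z \<in> blocks" using m assms(1) subspace_blocks by (metis add_diff_cancel_left' subspace_diff)
  then have "z \<in> stresses h"
    unfolding stresses_eq_orthogonal using z by (auto simp: orthogonal_commute span_base)
  then have "z \<bullet> m = 0" by (rule assms(2))
  moreover have "z \<bullet> y = 0" using z[OF y] by (simp add: orthogonal_def)
  ultimately have "z = 0" by (simp add: m inner_add_right)
  with m y' show ?thesis by (simp add: concurrences_def)
qed

lemma merge_if_not_separated:
  assumes "\<not> separated H"
  obtains h h' where "h \<in> H" "h' \<in> H" "h \<noteq> h'" "stresses (h \<union> h') \<subseteq> stress_span H"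
proof -
  obtain h h' where h: "h \<in> H" "h' \<in> H" "h \<noteq> h'"
    and eq: "\<And>m w. \<forall>k\<in>H. concurrent k m (w k) \<Longrightarrow> w h = w h'"
    using assms unfolding separated_def by blast
  have "x \<in> stress_span H" if x: "x \<in> stresses (h \<union> h')" for x
  proof -
    obtain y m where y: "y \<in> span (stress_span H)"
      and m: "\<And>x. x \<in> span (stress_span H) \<Longrightarrow> orthogonal m x" and xy: "x = y + m"
      using orthogonal_subspace_decomp_exists[of "stress_span H" x] by blast
    have y': "y \<in> stress_span H" using y by (simp add: stress_span_def span_span)
    have "x \<in> blocks" using x by (simp add: stresses_def)
    moreover have "y \<in> blocks" using y' stress_span_subset_blocks by blast
    ultimately have mb: "m \<in> blocks" using xy subspace_blocks by (metis add_diff_cancel_left' subspace_diff)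
    have "\<exists>w. concurrent k (\<lambda>v. m $ v) w" if "k \<in> H" for k
    proof (rule concurrent_if_orthogonal[OF mb])
      fix x assume "x \<in> stresses k"
      then have "x \<in> stress_span H" using that by (auto simp: stress_span_def intro: span_base)
      then show "x \<bullet> m = 0" using m[of x] by (simp add: span_base orthogonal_def inner_commute)
    qed
    then obtain w where w: "\<forall>k\<in>H. concurrent k (\<lambda>v. m $ v) (w k)" by metis
    from eq[OF this] have "concurrent (h \<union> h') (\<lambda>v. m $ v) (w h)"
      using w h by (auto simp: concurrent_def)
    with x have "x \<bullet> m = 0" by (rule concurrent_orthogonal)
    moreover have "y \<bullet> m = 0" using m[OF y] by (simp add: orthogonal_def inner_commute)
    ultimately have "m = 0" by (simp add: xy inner_add_left)
    with xy y' show ?thesis by simp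
  qed
  with h that show ?thesis by blast
qed

lemma separated_meet:
  assumes "separated H" "h \<in> H" "h' \<in> H" "h \<noteq> h'"
  obtains m w where "\<forall>k\<in>H. concurrent k m (w k)" "w h \<noteq> w h'"
    "\<And>u. u \<in> h \<Longrightarrow> u \<in> h' \<Longrightarrow> w h - w h' \<in> span {q u}"
proof -
  obtain m w where mw: "\<forall>k\<in>H. concurrent k m (w k)" "w h \<noteq> w h'"
    using assms unfolding separated_def by blast
  moreover have "w h - w h' \<in> span {q u}" if "u \<in> h" "u \<in> h'" for u
  proof -
    have "m u - w h' \<in> span {q u}" "m u - w h \<in> span {q u}"
      using mw(1) that assms by (auto simp: concurrent_def)
    then show ?thesis using span_diff[of "m u - w h'" _ "m u - w h"] by simp
  qed
  ultimately show ?thesis using that by blast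
qed

lemma separated_common_rod:
  assumes "separated H" "h \<in> H" "h' \<in> H" "h \<noteq> h'" "u \<in> h" "u \<in> h'"
  shows "u \<in> R"
proof -
  obtain w where "w h \<noteq> w h'" "w h - w h' \<in> span {q u}"
    using separated_meet[OF assms(1-4)] assms(5,6) by metis
  then show "u \<in> R" using q_body[of u] by (cases "u \<in> R") auto
qed

lemma separated_common_unique:
  assumes "separated H" "h \<in> H" "h' \<in> H" "h \<noteq> h'"
    and "u \<in> h" "u \<in> h'" "v \<in> h" "v \<in> h'"
  shows "u = v"
proof -
  obtain w where "w h \<noteq> w h'" "w h - w h' \<in> span {q u}" "w h - w h' \<in> span {q v}"
    using separated_meet[OF assms(1-4)] assms(5-8) by metis
  then show "u = v" using span_q_Int[of u v "w h - w h'"] by auto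
qed

lemma gaps_eq_U_if_separated:
  assumes "separated H" "h \<in> H" "h' \<in> H" "h \<noteq> h'" "u \<in> h" "u \<in> h'"
  shows "U \<subseteq> gaps U q u H h h'"
proof (rule generic)
  obtain m w where mw: "\<forall>k\<in>H. concurrent k m (w k)" "w h \<noteq> w h'"
      "w h - w h' \<in> span {q u}"
    using separated_meet[OF assms(1-4)] assms(5,6) by metis
  have "w h - w h' \<in> gaps U q u H h h'" unfolding gaps_def
    by (rule CollectI, rule exI[of _ m], rule exI[of _ w]) (use mw(1) in \<open>auto simp: concurrent_def\<close>)
  moreover obtain a where a: "w h - w h' = a *\<^sub>R q u" using mw(3) by (auto simp: span_singleton)
  then have "q u = (1 / a) *\<^sub>R (w h - w h')" using mw(2) by auto
  ultimately show "q u \<in> gaps U q u H h h'" using subspace_gaps[OF subspace_U] by (metis subspace_scale)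
  show "u \<in> R" using separated_common_rod[OF assms] .
qed (use assms in auto)

lemma relation_at_vertex_orthogonal:
  assumes c: "\<forall>k\<in>H. c k \<in> stresses k" and rel: "(\<Sum>k\<in>H. c k) = 0"
    and w: "\<forall>k\<in>H. \<forall>v\<in>k - {u}. m v - w k \<in> span {q v}"
  shows "(\<Sum>k\<in>H. c k $ u \<bullet> w k) = 0"
proof -
  have vertex: "(\<Sum>k\<in>H. c k $ v) = 0" for v using rel by (metis sum_component zero_index)
  have *: "c k $ v \<bullet> w k = c k $ v \<bullet> m v" if "k \<in> H" "v \<noteq> u" for k v
  proof (cases "v \<in> k")
    case True
    then have "c k $ v \<bullet> (m v - w k) = 0"
      using c w that by (intro inner_span_q[of "c k $ v" v "m v - w k"]) (auto simp: stresses_def)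
    then show ?thesis by (simp add: inner_diff_right)
  qed (use c that in \<open>simp add: stresses_def\<close>)
  have other: "(\<Sum>k\<in>H. c k $ v \<bullet> w k) = 0" if "v \<noteq> u" for v
  proof -
    have "(\<Sum>k\<in>H. c k $ v \<bullet> w k) = (\<Sum>k\<in>H. c k $ v) \<bullet> m v"
      using * that by (simp add: inner_sum_left)
    then show ?thesis using vertex by simp
  qed
  have "0 = (\<Sum>k\<in>H. (\<Sum>v\<in>UNIV. c k $ v) \<bullet> w k)"
    using c by (simp add: stresses_def)
  also have "\<dots> = (\<Sum>v\<in>UNIV. \<Sum>k\<in>H. c k $ v \<bullet> w k)"
    unfolding inner_sum_left by (rule sum.swap)
  also have "\<dots> = (\<Sum>v\<in>UNIV. if v = u then \<Sum>k\<in>H. c k $ u \<bullet> w k else 0)"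
    using other by (intro sum.cong) auto
  finally show ?thesis by simp
qed

end

section \<open>The rank of the span of the stresses\<close>

lemma incidence_count_contradiction:
  fixes D I J N n s :: int
  assumes "4 \<le> D" "3 * N \<le> I" "I \<le> J + s" "2 \<le> s" "s \<le> N" "s * (n - 1) \<le> J" "1 \<le> n"
    and le: "(D - 1) * J - D * (n - 1) \<le> (D - 1) * N - D"
  shows False
proof (cases "s = 2")
  case True
  have "D * (2 * (n - 1)) \<le> D * J" using assms True by (intro mult_left_mono) auto
  then have "(D - 2) * J \<le> 2 * ((D - 1) * N - D)" using le by (simp add: algebra_simps)
  moreover have "(D - 2) * (3 * N - 2) \<le> (D - 2) * J"
    using assms True by (intro mult_left_mono) auto
  moreover have "4 * N \<le> D * N" using assms by (intro mult_right_mono) auto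
  ultimately show False by (simp add: algebra_simps)
next
  case False
  then have "3 * (n - 1) \<le> s * (n - 1)" using assms by (intro mult_right_mono) auto
  then have "D * (3 * (n - 1)) \<le> D * J" using assms by (intro mult_left_mono) auto
  then have "(2 * D - 3) * J \<le> 3 * ((D - 1) * N - D)" using le by (simp add: algebra_simps)
  moreover have "(2 * D - 3) * (2 * N) \<le> (2 * D - 3) * J"
    using assms by (intro mult_left_mono) auto
  moreover have "4 * N \<le> D * N" using assms by (intro mult_right_mono) auto
  ultimately show False using assms by (simp add: algebra_simps)
qed

context generic_directions begin

lemma support_card:
  assumes "x \<in> stresses h" "x \<noteq> 0"
  shows "2 \<le> card {v. x $ v \<noteq> 0}"
proof (rule ccontr)
  assume "\<not> 2 \<le> card {v. x $ v \<noteq> 0}"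
  then have le: "card {v. x $ v \<noteq> 0} \<le> Suc 0" by simp
  obtain u where u: "x $ u \<noteq> 0" using assms(2) by (auto simp: vec_eq_iff)
  have "x $ v = 0" if "v \<noteq> u" for v
    using le u that by (auto simp: card_le_Suc0_iff_eq)
  then have "(\<Sum>v\<in>UNIV. x $ v) = (\<Sum>v\<in>UNIV. if v = u then x $ u else 0)"
    by (intro sum.cong) auto
  then have "(\<Sum>v\<in>UNIV. x $ v) = x $ u" by simp
  with u assms(1) show False by (simp add: stresses_def)
qed

lemma relation_degree:
  assumes sep: "separated H" and c: "\<forall>k\<in>H. c k \<in> stresses k" and rel: "(\<Sum>k\<in>H. c k) = 0"
    and h: "h \<in> H" "c h $ u \<noteq> 0"
  shows "u \<in> R" and "3 \<le> card {k\<in>H. c k $ u \<noteq> 0}"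
proof -
  let ?S = "{k\<in>H. c k $ u \<noteq> 0}"
  have supp: "u \<in> k" if "k \<in> H" "c k $ u \<noteq> 0" for k using c that by (auto simp: stresses_def)
  have "(\<Sum>k\<in>H. c k $ u) = 0" using rel by (metis sum_component zero_index)
  moreover have "(\<Sum>k\<in>H. c k $ u) = (\<Sum>k\<in>?S. c k $ u)"
    by (intro sum.mono_neutral_right) auto
  ultimately have sumS: "(\<Sum>k\<in>?S. c k $ u) = 0" by simp
  have hS: "h \<in> ?S" using h by simp
  have "?S \<noteq> {h}" using sumS h(2) by auto
  then obtain h' where h': "h' \<in> H" "c h' $ u \<noteq> 0" "h' \<noteq> h" using hS by auto
  show "u \<in> R" using separated_common_rod[OF sep h(1) h'(1) _ supp[OF h] supp[OF h'(1,2)]] h'(3) by simp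
  show "3 \<le> card ?S"
  proof (rule ccontr)
    assume "\<not> 3 \<le> card ?S"
    moreover have "{h, h'} \<subseteq> ?S" using hS h' by auto
    moreover have "card {h, h'} = 2" using h'(3) by simp
    ultimately have S: "?S = {h, h'}" using card_seteq[of ?S "{h, h'}"] by simp
    then have y: "c h' $ u = - c h $ u" using sumS h'(3) by (simp add: add_eq_0_iff)
    have "c h $ u \<in> U" using c h by (auto simp: stresses_def blocks_def)
    then have "c h $ u \<in> gaps U q u H h h'"
      using gaps_eq_U_if_separated[OF sep h(1) h'(1) _ supp[OF h] supp[OF h'(1,2)]] h'(3) by blast
    then obtain m w where mw: "c h $ u = w h - w h'"
      and w: "\<forall>k\<in>H. w k \<in> U \<and> (\<forall>v\<in>k - {u}. m v - w k \<in> span {q v})"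
      unfolding gaps_def by blast
    have "0 = (\<Sum>k\<in>H. c k $ u \<bullet> w k)"
      using relation_at_vertex_orthogonal[OF c rel, of u m w] w by simp
    also have "\<dots> = (\<Sum>k\<in>?S. c k $ u \<bullet> w k)" by (intro sum.mono_neutral_right) auto
    also have "\<dots> = c h $ u \<bullet> (w h - w h')"
      unfolding S using y h'(3) by (simp add: inner_diff_right)
    finally have "c h $ u \<bullet> c h $ u = 0" by (simp flip: mw)
    with h(2) show False by simp
  qed
qed

lemma separated_reindex:
  assumes "separated H" "K \<subseteq> H" "\<And>k. k \<in> K \<Longrightarrow> g k \<subseteq> k" "inj_on g K"
  shows "separated (g ` K)"
  unfolding separated_def
proof (intro ballI impI)
  fix a b assume ab: "a \<in> g ` K" "b \<in> g ` K" "a \<noteq> b"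
  then obtain h h' where h: "h \<in> K" "h' \<in> K" "a = g h" "b = g h'" by blast
  then have "h \<noteq> h'" using ab by blast
  moreover have "h \<in> H" "h' \<in> H" using h assms(2) by auto
  ultimately obtain m w where mw: "\<forall>k\<in>H. concurrent k m (w k)" "w h \<noteq> w h'"
    using assms(1) unfolding separated_def by blast
  have inv: "the_inv_into K g (g k) = k" if "k \<in> K" for k
    using assms(4) that by (rule the_inv_into_f_f)
  have "\<forall>k\<in>g ` K. concurrent k m (w (the_inv_into K g k))"
  proof
    fix a assume "a \<in> g ` K"
    then obtain k where k: "k \<in> K" "a = g k" by blast
    then have "concurrent k m (w k)" using mw(1) assms(2) by blast
    then show "concurrent a m (w (the_inv_into K g a))"
      using k assms(3)[of k] inv by (auto simp: concurrent_def)
  qed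
  then show "\<exists>m w. (\<forall>k\<in>g ` K. concurrent k m (w k)) \<and> w a \<noteq> w b"
    using mw(2) h inv by (intro exI[of _ m] exI[of _ "\<lambda>k. w (the_inv_into K g k)"]) auto
qed

lemma dim_stress_span_le:
  assumes "\<And>h. h \<in> H \<Longrightarrow> h \<subseteq> V" "2 \<le> card V"
  shows "int (dim (stress_span H)) \<le> sparsity V"
proof -
  have "stress_span H \<subseteq> stresses V" unfolding stress_span_def
    by (rule span_minimal[OF _ subspace_stresses]) (use assms stresses_mono in blast)
  then have "dim (stress_span H) \<le> dim (stresses V)" by (rule dim_subset)
  then show ?thesis using dim_stresses[OF assms(2)] by simp
qed

lemma separated_sparsity_le:
  assumes "separated H" "\<And>h. h \<in> H \<Longrightarrow> 2 \<le> card h"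
  shows "(\<Sum>h\<in>H. sparsity h) \<le> int (dim (stress_span H))"
  using assms
proof (induction "card H" arbitrary: H rule: less_induct)
  case less
  show ?case
  proof (cases "\<exists>c. (\<forall>k\<in>H. c k \<in> stresses k) \<and> (\<Sum>k\<in>H. c k) = 0 \<and> (\<exists>k\<in>H. c k \<noteq> 0)")
    case False
    then have "dim (stress_span H) = (\<Sum>h\<in>H. dim (stresses h))"
      unfolding stress_span_def by (intro dim_direct_sum subspace_stresses) auto
    then show ?thesis using dim_stresses less.prems(2) by simp
  next
    case True
    then obtain c h where c: "\<forall>k\<in>H. c k \<in> stresses k" and rel: "(\<Sum>k\<in>H. c k) = 0"
      and h: "h \<in> H" "c h \<noteq> 0" by blast
    define g where "g k = {v. c k $ v \<noteq> 0}" for k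
    define K where "K = {k \<in> H. c k \<noteq> 0}"
    define V where "V = (\<Union>k\<in>K. g k)"
    have KH: "K \<subseteq> H" by (auto simp: K_def)
    have hK: "h \<in> K" using h by (simp add: K_def)
    have g_sub: "g k \<subseteq> k" if "k \<in> K" for k
      using c that by (auto simp: g_def K_def stresses_def)
    have g_card: "2 \<le> card (g k)" if "k \<in> K" for k
      using support_card c that by (auto simp: g_def K_def)
    have g_inj: "inj_on g K"
    proof (rule inj_onI, rule ccontr)
      fix a b assume ab: "a \<in> K" "b \<in> K" "g a = g b" "a \<noteq> b"
      obtain u v where uv: "u \<in> g a" "v \<in> g a" "u \<noteq> v" using two_elements[OF g_card[OF ab(1)]] .
      then have "u \<in> a" "u \<in> b" "v \<in> a" "v \<in> b" using g_sub ab by blast+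
      then show False
        using separated_common_unique[OF less.prems(1), of a b u v] ab KH uv(3) by blast
    qed
    have V_R: "V \<subseteq> R"
      using relation_degree(1)[OF less.prems(1) c rel] by (auto simp: V_def K_def g_def)
    have deg: "3 \<le> card {k \<in> K. v \<in> g k}" if v: "v \<in> V" for v
    proof -
      obtain k where "k \<in> H" "c k $ v \<noteq> 0" using v by (auto simp: V_def K_def g_def)
      then have "3 \<le> card {k \<in> H. c k $ v \<noteq> 0}"
        using relation_degree(2)[OF less.prems(1) c rel] by blast
      also have "{k \<in> H. c k $ v \<noteq> 0} = {k \<in> K. v \<in> g k}" by (auto simp: K_def g_def)
      finally show ?thesis .
    qed
    \<comment> \<open>minimality is needed for the incidence count after the removal of \<open>k0\<close>\<close>
    define k0 where "k0 = arg_min_on (\<lambda>k. card (g k)) K"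
    have k0: "k0 \<in> K" unfolding k0_def using hK by (intro arg_min_if_finite(1)) auto
    have k0_min: "card (g k0) \<le> card (g k)" if "k \<in> K" for k
      unfolding k0_def using that by (intro arg_min_least) auto
    let ?K = "K - {k0}"
    have "card (g ` ?K) \<le> card ?K" by (rule card_image_le) simp
    also have "\<dots> < card K" using k0 by (intro psubset_card_mono) auto
    also have "\<dots> \<le> card H" using KH by (intro card_mono) auto
    finally have "(\<Sum>s\<in>g ` ?K. sparsity s) \<le> int (dim (stress_span (g ` ?K)))"
    proof (rule less.hyps)
      show "separated (g ` ?K)"
        by (rule separated_reindex[OF less.prems(1)])
          (use KH g_sub g_inj in \<open>auto intro: inj_on_subset\<close>)
      show "\<And>s. s \<in> g ` ?K \<Longrightarrow> 2 \<le> card s" using g_card by auto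
    qed
    also have "\<dots> \<le> sparsity V"
    proof (rule dim_stress_span_le)
      have "card (g h) \<le> card V" using hK by (intro card_mono) (auto simp: V_def)
      with g_card[OF hK] show "2 \<le> card V" by simp
    qed (auto simp: V_def)
    also have "(\<Sum>s\<in>g ` ?K. sparsity s) = (\<Sum>k\<in>?K. sparsity (g k))"
      using g_inj by (intro sum.reindex_cong[of g ?K]) (auto intro: inj_on_subset)
    finally have le: "(\<Sum>k\<in>?K. sparsity (g k)) \<le> sparsity V" .
    define J where "J = (\<Sum>k\<in>?K. int (card (g k)))"
    let ?D = "int (dim U)"
    have count_R: "sparsity s = (?D - 1) * int (card s) - ?D" if "s \<subseteq> R" for s
      using that by (simp add: sparsity_def Int_absorb1 algebra_simps)
    have "g k \<subseteq> R" if "k \<in> K" for k using V_R that by (auto simp: V_def)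
    then have "(\<Sum>k\<in>?K. sparsity (g k)) = (\<Sum>k\<in>?K. (?D - 1) * int (card (g k)) - ?D)"
      by (intro sum.cong) (auto intro!: count_R)
    also have "\<dots> = (?D - 1) * J - ?D * int (card ?K)"
      by (simp add: J_def sum_subtractf sum_distrib_left)
    also have "int (card ?K) = int (card K) - 1"
      using k0 by (simp add: card_Diff_singleton) (metis One_nat_def Suc_leI card_gt_0_iff empty_iff finite of_nat_1 of_nat_diff)
    finally have le': "(?D - 1) * J - ?D * (int (card K) - 1) \<le> (?D - 1) * int (card V) - ?D"
      using le count_R[OF V_R] by simp
    have K_J: "(\<Sum>k\<in>K. int (card (g k))) = J + int (card (g k0))"
      unfolding J_def using k0 by (simp add: sum.remove[of K k0])
    have "(\<Sum>k\<in>K. int (card (g k))) = (\<Sum>k\<in>K. \<Sum>v\<in>V. if v \<in> g k then 1 else 0)"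
    proof (rule sum.cong)
      fix k assume "k \<in> K"
      then have "V \<inter> g k = g k" by (auto simp: V_def)
      then show "int (card (g k)) = (\<Sum>v\<in>V. if v \<in> g k then 1 else 0)"
        by (simp add: sum.If_cases)
    qed simp
    also have "\<dots> = (\<Sum>v\<in>V. \<Sum>k\<in>K. if v \<in> g k then 1 else 0)" by (rule sum.swap)
    also have "\<dots> = (\<Sum>v\<in>V. int (card {k \<in> K. v \<in> g k}))"
      by (intro sum.cong) (auto simp: sum.If_cases Int_def)
    also have "\<dots> \<ge> (\<Sum>v\<in>V. 3)" using deg by (intro sum_mono) fastforce
    finally have I: "3 * int (card V) \<le> (\<Sum>k\<in>K. int (card (g k)))" by simp
    have s: "int (card (g k0)) * (int (card K) - 1) \<le> J"
    proof -
      have "(\<Sum>k\<in>?K. int (card (g k0))) \<le> J"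
        unfolding J_def using k0_min by (intro sum_mono) auto
      then show ?thesis using \<open>int (card ?K) = int (card K) - 1\<close> by (simp add: mult.commute)
    qed
    have "card (g k0) \<le> card V" using k0 by (intro card_mono) (auto simp: V_def)
    moreover have "1 \<le> int (card K)" using k0 by (simp add: Suc_le_eq card_gt_0_iff) blast
    ultimately have False
      using incidence_count_contradiction[of ?D "int (card V)" "J + int (card (g k0))" J "int (card (g k0))" "int (card K)"]
        dim_U I K_J s le' g_card[OF k0] by simp
    then show ?thesis ..
  qed
qed

end

lemma partition_on_vimage_of:
  assumes "partition_on (e ` F) P"
  shows "partition_on F ((\<lambda>X. {k\<in>F. e k \<in> X}) ` P)"
    and "inj_on (\<lambda>X. {k\<in>F. e k \<in> X}) P"
proof -
  have P: "\<Union>P = e ` F" "{} \<notin> P"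
    using partition_onD1[OF assms] partition_onD3[OF assms] by simp_all
  have disj: "X \<inter> Y = {}" if "X \<in> P" "Y \<in> P" "X \<noteq> Y" for X Y
    using partition_onD2[OF assms] that by (rule disjointD)
  have ne: "{k\<in>F. e k \<in> X} \<noteq> {}" if "X \<in> P" for X
  proof -
    have "X \<noteq> {}" "X \<subseteq> e ` F" using that P by auto
    then show ?thesis by blast
  qed
  show "partition_on F ((\<lambda>X. {k\<in>F. e k \<in> X}) ` P)"
  proof (rule partition_onI)
    have "\<exists>X\<in>P. e k \<in> X" if "k \<in> F" for k using P(1) that by (metis UnionE imageI)
    then show "\<Union>((\<lambda>X. {k\<in>F. e k \<in> X}) ` P) = F" by auto
    show "{} \<notin> (\<lambda>X. {k\<in>F. e k \<in> X}) ` P" using ne by fastforce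
    fix p p' assume "p \<in> (\<lambda>X. {k\<in>F. e k \<in> X}) ` P" "p' \<in> (\<lambda>X. {k\<in>F. e k \<in> X}) ` P" "p \<noteq> p'"
    then obtain X Y where XY: "X \<in> P" "Y \<in> P" "p = {k\<in>F. e k \<in> X}" "p' = {k\<in>F. e k \<in> Y}" "X \<noteq> Y"
      by blast
    then have "X \<inter> Y = {}" using disj by blast
    then show "disjnt p p'" unfolding XY disjnt_def by blast
  qed
  show "inj_on (\<lambda>X. {k\<in>F. e k \<in> X}) P"
  proof (rule inj_onI, rule ccontr)
    fix X Y assume XY: "X \<in> P" "Y \<in> P" "{k\<in>F. e k \<in> X} = {k\<in>F. e k \<in> Y}" "X \<noteq> Y"
    then have "{k\<in>F. e k \<in> X} = {}" using disj[of X Y] by blast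
    then show False using ne XY by blast
  qed
qed

context generic_directions begin

lemma exists_partition_sparsity_le:
  assumes "\<And>h. h \<in> H \<Longrightarrow> 2 \<le> card h"
  shows "\<exists>P. partition_on H P \<and> (\<Sum>X\<in>P. sparsity (\<Union>X)) \<le> int (dim (stress_span H))"
  using assms
proof (induction "card H" arbitrary: H rule: less_induct)
  case less
  show ?case
  proof (cases "separated H")
    case True
    have "partition_on H ((\<lambda>h. {h}) ` H)" by (auto intro: partition_onI simp: disjnt_def)
    moreover have "(\<Sum>X\<in>(\<lambda>h. {h}) ` H. sparsity (\<Union>X)) = (\<Sum>h\<in>H. sparsity h)"
      by (subst sum.reindex) auto
    ultimately show ?thesis using separated_sparsity_le[OF True less.prems] by metis
  next
    case False
    then obtain h h' where h: "h \<in> H" "h' \<in> H" "h \<noteq> h'"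
      and sub: "stresses (h \<union> h') \<subseteq> stress_span H" using merge_if_not_separated by metis
    define \<phi> where "\<phi> k = (if k = h \<or> k = h' then h \<union> h' else k)" for k
    have "\<phi> ` H \<subseteq> insert (h \<union> h') (H - {h, h'})" by (auto simp: \<phi>_def)
    then have "card (\<phi> ` H) \<le> card (insert (h \<union> h') (H - {h, h'}))" by (intro card_mono) auto
    also have "\<dots> \<le> Suc (card (H - {h, h'}))" by (rule card_insert_le_m1) auto
    also have "card (H - {h, h'}) + 2 = card H"
      using h card_mono[of H "{h, h'}"] by (subst card_Diff_subset) auto
    then have "Suc (card (H - {h, h'})) < card H" by simp
    finally have lt: "card (\<phi> ` H) < card H" .
    have two: "2 \<le> card s" if "s \<in> \<phi> ` H" for s
    proof (cases "s = h \<union> h'")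
      case True
      have "card h \<le> card (h \<union> h')" by (intro card_mono) auto
      then show ?thesis using less.prems[OF h(1)] True by simp
    qed (use that less.prems in \<open>auto simp: \<phi>_def split: if_splits\<close>)
    obtain P where P: "partition_on (\<phi> ` H) P"
      and le: "(\<Sum>X\<in>P. sparsity (\<Union>X)) \<le> int (dim (stress_span (\<phi> ` H)))"
      using less.hyps[OF lt two] by blast
    have "stresses s \<subseteq> stress_span H" if "s \<in> \<phi> ` H" for s
    proof (cases "s = h \<union> h'")
      case False
      then have "s \<in> H" using that by (auto simp: \<phi>_def split: if_splits)
      then show ?thesis by (auto simp: stress_span_def intro: span_base)
    qed (use sub in simp)
    then have "stress_span (\<phi> ` H) \<subseteq> stress_span H"
      unfolding stress_span_def[of "\<phi> ` H"]
      by (intro span_minimal) (auto simp: stress_span_def)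
    then have "dim (stress_span (\<phi> ` H)) \<le> dim (stress_span H)" by (rule dim_subset)
    moreover have "(\<Sum>X\<in>(\<lambda>X. {k\<in>H. \<phi> k \<in> X}) ` P. sparsity (\<Union>X)) = (\<Sum>X\<in>P. sparsity (\<Union>X))"
    proof (subst sum.reindex[OF partition_on_vimage_of(2)[OF P]], rule sum.cong)
      fix X assume "X \<in> P"
      then have X: "X \<subseteq> \<phi> ` H" using P by (auto simp: partition_on_def)
      have "\<Union>{k\<in>H. \<phi> k \<in> X} = \<Union>X"
      proof
        show "\<Union>{k\<in>H. \<phi> k \<in> X} \<subseteq> \<Union>X" by (auto simp: \<phi>_def split: if_splits)
        show "\<Union>X \<subseteq> \<Union>{k\<in>H. \<phi> k \<in> X}"
        proof clarify
          fix v s assume v: "v \<in> s" "s \<in> X"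
          then obtain k where k: "k \<in> H" "s = \<phi> k" using X by blast
          show "v \<in> \<Union>{k\<in>H. \<phi> k \<in> X}"
          proof (cases "k = h \<or> k = h'")
            case True
            then have "v \<in> h \<or> v \<in> h'" "\<phi> h \<in> X" "\<phi> h' \<in> X" using v k by (auto simp: \<phi>_def)
            then show ?thesis using h by blast
          qed (use v k in \<open>auto simp: \<phi>_def\<close>)
        qed
      qed
      then show "((\<lambda>X. sparsity (\<Union>X)) \<circ> (\<lambda>X. {k\<in>H. \<phi> k \<in> X})) X = sparsity (\<Union>X)" by simp
    qed simp
    ultimately show ?thesis using partition_on_vimage_of(1)[OF P] le
      by (intro exI[of _ "(\<lambda>X. {k\<in>H. \<phi> k \<in> X}) ` P"]) simp
  qed
qed

theorem dim_stress_span_eq_Min: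
  fixes e :: "'e \<Rightarrow> 'v set"
  assumes "finite F" "\<And>f. f \<in> F \<Longrightarrow> 2 \<le> card (e f)"
  shows "int (dim (stress_span (e ` F))) = Min {(\<Sum>X\<in>P. sparsity (\<Union>(e ` X))) | P. partition_on F P}"
proof -
  have lower: "int (dim (stress_span (e ` F))) \<le> (\<Sum>X\<in>P. sparsity (\<Union>(e ` X)))"
    if P: "partition_on F P" for P
  proof -
  have fin: "finite P" using finite_elements[OF assms(1) P] .
  have "(\<Union>h\<in>e ` F. stresses h) \<subseteq> (\<Union>X\<in>P. stress_span (e ` X))"
  proof clarify
    fix x f assume x: "f \<in> F" "x \<in> stresses (e f)"
    then obtain X where "X \<in> P" "f \<in> X" using P by (auto simp: partition_on_def)
    then show "x \<in> (\<Union>X\<in>P. stress_span (e ` X))" using x by (auto simp: stress_span_def intro!: span_base)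
  qed
  then have "stress_span (e ` F) \<subseteq> span (\<Union>X\<in>P. stress_span (e ` X))"
    unfolding stress_span_def[of "e ` F"] by (rule span_mono)
  then have "dim (stress_span (e ` F)) \<le> dim (span (\<Union>X\<in>P. stress_span (e ` X)))" by (rule dim_subset)
  also have "\<dots> \<le> (\<Sum>X\<in>P. dim (stress_span (e ` X)))" by (rule dim_sum_le[OF fin])
  finally have "int (dim (stress_span (e ` F))) \<le> (\<Sum>X\<in>P. int (dim (stress_span (e ` X))))"
    by (metis of_nat_mono of_nat_sum)
  also have "\<dots> \<le> (\<Sum>X\<in>P. sparsity (\<Union>(e ` X)))"
  proof (rule sum_mono)
    fix X assume X: "X \<in> P"
    then have "X \<noteq> {}" "X \<subseteq> F" using P by (auto simp: partition_on_def)
    then obtain f where f: "f \<in> X" "f \<in> F" by blast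
    show "int (dim (stress_span (e ` X))) \<le> sparsity (\<Union>(e ` X))"
    proof (rule dim_stress_span_le)
      have "card (e f) \<le> card (\<Union>(e ` X))" using f by (intro card_mono) auto
      then show "2 \<le> card (\<Union>(e ` X))" using assms(2)[OF f(2)] by simp
    qed auto
  qed
  finally show ?thesis .
  qed
  obtain P where P: "partition_on (e ` F) P"
    and le: "(\<Sum>X\<in>P. sparsity (\<Union>X)) \<le> int (dim (stress_span (e ` F)))"
    using exists_partition_sparsity_le[of "e ` F"] assms(2) by auto
  define Q where "Q = (\<lambda>X. {k\<in>F. e k \<in> X}) ` P"
  have Q: "partition_on F Q" unfolding Q_def by (rule partition_on_vimage_of(1)[OF P])
  have "(\<Sum>X\<in>Q. sparsity (\<Union>(e ` X))) = (\<Sum>X\<in>P. sparsity (\<Union>X))"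
    unfolding Q_def
  proof (subst sum.reindex[OF partition_on_vimage_of(2)[OF P]], rule sum.cong)
    fix X assume "X \<in> P"
    then have "X \<subseteq> e ` F" using P by (auto simp: partition_on_def)
    then have "e ` {k\<in>F. e k \<in> X} = X" by auto
    then show "((\<lambda>X. sparsity (\<Union>(e ` X))) \<circ> (\<lambda>X. {k\<in>F. e k \<in> X})) X = sparsity (\<Union>X)" by simp
  qed simp
  with le lower[OF Q] have eq: "int (dim (stress_span (e ` F))) = (\<Sum>X\<in>Q. sparsity (\<Union>(e ` X)))" by simp
  show ?thesis
  proof (rule sym, rule Min_eqI)
    have "{(\<Sum>X\<in>P. sparsity (\<Union>(e ` X))) | P. partition_on F P} =
        (\<lambda>P. \<Sum>X\<in>P. sparsity (\<Union>(e ` X))) ` {P. partition_on F P}" by auto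
    then show "finite {(\<Sum>X\<in>P. sparsity (\<Union>(e ` X))) | P. partition_on F P}"
      using finitely_many_partition_on[OF assms(1)] by simp
    show "int (dim (stress_span (e ` F))) \<in> {(\<Sum>X\<in>P. sparsity (\<Union>(e ` X))) | P. partition_on F P}"
      using eq Q by blast
  qed (use lower in blast)
qed

end

section \<open>Pluecker vectors of rods\<close>

definition ext_star :: "('n::{finite,linorder}) ext \<Rightarrow> 'n ext" where
  "ext_star s = (\<chi> S. if card S = 2 then shuffle_sign S (UNIV - S) * s $ (UNIV - S) else 0)"

lemma subspace_ext_power: "subspace (ext_power k)"
  by (auto simp: ext_power_def subspace_def)

lemma dim_ext_power: "dim (ext_power k :: ('n::{finite,linorder}) ext set) = CARD('n) choose k"
proof -
  have "ext_power k = {p :: 'n ext. \<forall>S. p $ S \<in> (if card S = k then UNIV else {0})}"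
    by (auto simp: ext_power_def)
  moreover have "subspace (if card S = k then UNIV else {0::real})" for S :: "'n set" by simp
  ultimately have "dim (ext_power k :: 'n ext set) = (\<Sum>S\<in>(UNIV::'n set set). dim (if card S = k then UNIV else {0::real}))"
    using dim_vec_blocks[of "\<lambda>S::'n set. if card S = k then UNIV else {0::real}"] by simp
  also have "\<dots> = (\<Sum>S\<in>(UNIV::'n set set). if card S = k then 1 else 0)"
    by (intro sum.cong) auto
  also have "\<dots> = card {S :: 'n set. S \<subseteq> UNIV \<and> card S = k}"
    by (simp add: sum.If_cases)
  also have "\<dots> = CARD('n) choose k" by (rule n_subsets) simp
  finally show ?thesis .
qed

lemma ext_star_in_ext_power: "ext_star s \<in> ext_power 2"
  by (simp add: ext_star_def ext_power_def)

lemma linear_ext_star: "linear ext_star"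
  by (rule linearI) (auto simp: ext_star_def vec_eq_iff algebra_simps)

lemma ext_pairing_eq_inner_ext_star:
  assumes "p \<in> ext_power 2"
  shows "ext_pairing p s = p \<bullet> ext_star s"
proof -
  have "ext_pairing p s = (\<Sum>S\<in>UNIV. shuffle_sign S (UNIV - S) * p $ S * s $ (UNIV - S))"
    by (simp add: ext_pairing_def wedge_def)
  also have "\<dots> = p \<bullet> ext_star s"
    unfolding inner_vec_def using assms by (intro sum.cong) (auto simp: ext_star_def ext_power_def)
  finally show ?thesis .
qed

lemma linear_ext_of_vec: "linear ext_of_vec"
  unfolding ext_of_vec_def
  by (rule linearI)
    (auto simp: vec_eq_iff axis_def sum_distrib_left simp flip: sum.distrib intro!: sum.cong)

lemma bilinear_wedge: "bilinear wedge"
  unfolding bilinear_def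
  by (auto intro!: linearI simp: wedge_def vec_eq_iff algebra_simps sum.distrib sum_distrib_left)

lemma linear_wedge_left: "linear (\<lambda>p. wedge p s)"
  using bilinear_wedge unfolding bilinear_def by blast

lemma linear_wedge_right: "linear (\<lambda>s. wedge p s)"
  using bilinear_wedge unfolding bilinear_def by blast

lemma bounded_bilinear_wedge: "bounded_bilinear wedge"
  using bilinear_wedge by (simp add: bilinear_conv_bounded_bilinear)

lemma wedge_list_Cons: "wedge_list (x # xs) = wedge (ext_of_vec x) (wedge_list xs)"
  by (simp add: wedge_list_def)

lemma wedge_axis:
  assumes "i \<notin> T"
  shows "wedge (axis {i} a) (axis T c) = axis (insert i T) (shuffle_sign {i} T * a * c)"
proof -
  have "wedge (axis {i} a) (axis T c) $ S = axis (insert i T) (shuffle_sign {i} T * a * c) $ S" for S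
  proof -
    have "wedge (axis {i} a) (axis T c) $ S =
        (\<Sum>X\<in>Pow S. if X = {i} then if S = insert i T then shuffle_sign {i} T * a * c else 0 else 0)"
      unfolding wedge_def vec_lambda_beta
    proof (rule sum.cong)
      fix X assume "X \<in> Pow S"
      then show "shuffle_sign X (S - X) * axis {i} a $ X * axis T c $ (S - X) =
          (if X = {i} then if S = insert i T then shuffle_sign {i} T * a * c else 0 else 0)"
        using assms by (auto simp: axis_def)
    qed simp
    then show ?thesis by (auto simp: axis_def)
  qed
  then show ?thesis by (simp add: vec_eq_iff)
qed

lemma shuffle_sign_nonzero: "shuffle_sign S T \<noteq> 0"
  by (simp add: shuffle_sign_def)

lemma wedge_list_axis:
  assumes "distinct is"
  shows "\<exists>c\<noteq>0. wedge_list (map (\<lambda>i. axis i 1) is) = axis (set is) c"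
  using assms
proof (induction "is")
  case Nil
  show ?case by (auto simp: wedge_list_def)
next
  case (Cons i "is")
  then obtain c where c: "c \<noteq> 0" "wedge_list (map (\<lambda>i. axis i 1) is) = axis (set is) c" by auto
  have "ext_of_vec (axis i 1) = (\<Sum>j\<in>UNIV. if j = i then axis {i} 1 else 0)"
    unfolding ext_of_vec_def by (intro sum.cong) (auto simp: axis_def vec_eq_iff)
  then have "ext_of_vec (axis i 1) = axis {i} 1" by simp
  then have "wedge_list (map (\<lambda>i. axis i 1) (i # is)) = axis (set (i # is)) (shuffle_sign {i} (set is) * 1 * c)"
    using c Cons.prems by (simp add: wedge_list_Cons wedge_axis)
  then show ?case using c shuffle_sign_nonzero by (metis mult_eq_0_iff zero_neq_one)
qed

lemma measurable_wedge_list: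
  fixes f :: "'k \<Rightarrow> 'b \<Rightarrow> real ^ ('n::{finite,linorder})"
  assumes "\<And>k. k \<in> set ks \<Longrightarrow> f k \<in> borel_measurable M"
  shows "(\<lambda>x. wedge_list (map (\<lambda>k. f k x) ks)) \<in> borel_measurable M"
  using assms
proof (induction ks)
  case Nil
  show ?case by (simp add: wedge_list_def)
next
  case (Cons k ks)
  have "(\<lambda>x. ext_of_vec (f k x)) \<in> borel_measurable M"
    by (rule borel_measurable_continuous_on[of ext_of_vec])
      (use Cons linear_continuous_on[OF linear_conv_bounded_linear[THEN iffD1, OF linear_ext_of_vec]] in auto)
  moreover have "continuous_on UNIV (\<lambda>x::'n ext \<times> 'n ext. wedge (fst x) (snd x))"
    by (rule bounded_bilinear.continuous_on[OF bounded_bilinear_wedge]) (auto intro: continuous_intros)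
  moreover have "(\<lambda>x. wedge_list (map (\<lambda>k. f k x) ks)) \<in> borel_measurable M" using Cons by simp
  ultimately show ?case
    using borel_measurable_continuous_Pair[where H = wedge] by (simp add: wedge_list_Cons)
qed

lemma AE_lborel_linear_nonzero:
  fixes \<phi> :: "'a::euclidean_space \<Rightarrow> real"
  assumes "linear \<phi>" "\<phi> x0 \<noteq> 0"
  shows "AE x in lborel. \<phi> x \<noteq> 0"
proof -
  define a where "a = adjoint \<phi> 1"
  have eq: "a \<bullet> x = \<phi> x" for x
    using adjoint_works[OF assms(1), of x 1] by (simp add: a_def inner_commute)
  then have "a \<noteq> 0" using assms(2) by (metis inner_zero_left)
  then have "{x. a \<bullet> x = 0} \<in> null_sets lebesgue"
    using negligible_hyperplane[of a 0] by (simp add: negligible_iff_null_sets)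
  moreover have "{x. a \<bullet> x = 0} \<in> sets lborel"
    using closed_hyperplane[of a 0] by simp
  ultimately have "{x. a \<bullet> x = 0} \<in> null_sets lborel"
    by (metis null_sets_completion_iff)
  from AE_not_in[OF this] show ?thesis by (simp add: eq)
qed

lemma AE_wedge_list_nonzero:
  fixes \<phi> :: "('n::{finite,linorder}) ext \<Rightarrow> real"
  assumes "distinct ks" "linear \<phi>" "length ys = length ks" "\<phi> (wedge_list ys) \<noteq> 0"
  shows "AE x in (\<Pi>\<^sub>M k\<in>set ks. (lborel :: (real, 'n) vec measure)). \<phi> (wedge_list (map x ks)) \<noteq> 0"
  using assms
proof (induction ks arbitrary: \<phi> ys)
  case Nil
  then show ?case by simp
next
  case (Cons k ks)
  interpret product_sigma_finite "\<lambda>_. lborel :: (real, 'n) vec measure" by standard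
  let ?M = "\<lambda>K. (\<Pi>\<^sub>M k\<in>K. (lborel :: (real, 'n) vec measure))"
  obtain y zs where ys: "ys = y # zs" using Cons.prems(3) by (cases ys) auto
  have "linear (\<lambda>p. \<phi> (wedge (ext_of_vec y) p))"
    using linear_compose[OF linear_wedge_right Cons.prems(2)] by (simp add: comp_def)
  then have IH: "AE x in ?M (set ks). \<phi> (wedge (ext_of_vec y) (wedge_list (map x ks))) \<noteq> 0"
    using Cons.prems ys by (intro Cons.IH[of _ zs]) (auto simp: wedge_list_Cons)
  let ?bad = "{x. \<not> \<phi> (wedge_list (map x (k # ks))) \<noteq> 0}"
  have cont: "continuous_on UNIV \<phi>"
    using Cons.prems(2) by (simp add: linear_continuous_on linear_conv_bounded_linear)
  have "(\<lambda>x. wedge_list (map (\<lambda>k. x k) (k # ks))) \<in> borel_measurable (?M (insert k (set ks)))"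
    by (rule measurable_wedge_list[of "k # ks" "\<lambda>k x. x k"]) auto
  then have m: "(\<lambda>x. \<phi> (wedge_list (map x (k # ks)))) \<in> borel_measurable (?M (insert k (set ks)))"
    using borel_measurable_continuous_on[OF cont] by simp
  have "integral\<^sup>N (?M (insert k (set ks))) (indicator ?bad) =
      (\<integral>\<^sup>+x. (\<integral>\<^sup>+t. indicator ?bad (x(k := t)) \<partial>lborel) \<partial>?M (set ks))"
    using Cons.prems(1) m
    by (intro product_nn_integral_insert) (auto intro!: borel_measurable_indicator')
  also have "\<dots> = (\<integral>\<^sup>+x. 0 \<partial>?M (set ks))"
  proof (rule nn_integral_cong_AE)
    show "AE x in ?M (set ks). (\<integral>\<^sup>+t. indicator ?bad (x(k := t)) \<partial>lborel) = 0"
      using IH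
    proof (eventually_elim)
      case (elim x)
      let ?\<psi> = "\<lambda>t. \<phi> (wedge (ext_of_vec t) (wedge_list (map x ks)))"
      have "linear ?\<psi>"
        using linear_compose[OF linear_compose[OF linear_ext_of_vec linear_wedge_left] Cons.prems(2)]
        by (simp add: comp_def)
      then have "AE t in lborel. ?\<psi> t \<noteq> 0" using elim by (rule AE_lborel_linear_nonzero)
      moreover have "wedge_list (map (x(k := t)) (k # ks)) = wedge (ext_of_vec t) (wedge_list (map x ks))" for t
      proof -
        have "map (x(k := t)) ks = map x ks" using Cons.prems(1) by (intro map_cong) auto
        then show ?thesis by (simp only: list.map wedge_list_Cons fun_upd_same)
      qed
      ultimately have "AE t in lborel. indicator ?bad (x(k := t)) = (0::ennreal)"
        by (simp add: indicator_def del: list.map)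
      then have "(\<integral>\<^sup>+t. indicator ?bad (x(k := t)) \<partial>lborel) = (\<integral>\<^sup>+t. 0 \<partial>(lborel :: (real, 'n) vec measure))"
        by (rule nn_integral_cong_AE)
      then show ?case by simp
    qed
  qed
  also have "\<dots> = 0" by simp
  finally show ?case
    using m by (subst AE_iff_nn_integral) (auto simp: pred_def[symmetric])
qed

section \<open>Genericity of almost all rods\<close>

definition rod_directions ::
  "nat \<Rightarrow> 'v set \<Rightarrow> ('v \<times> nat \<Rightarrow> (real, 'n::{finite,linorder}) vec) \<Rightarrow> 'v \<Rightarrow> 'n ext" where
  "rod_directions d R x v = (if v \<in> R then ext_star (wedge_list (map (\<lambda>i. x (v, i)) [0..<d - 1])) else 0)"

lemma borel_projection:
  fixes T :: "('a::euclidean_space \<times> 'b::euclidean_space) set"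
  assumes "closed T"
  shows "{y. \<exists>x. (x, y) \<in> T} \<in> sets borel"
proof -
  have "\<exists>n::nat. x \<in> cball 0 (real n)" for x :: 'a
    using real_arch_simple[of "norm x"] by simp
  then have "{y. \<exists>x. (x, y) \<in> T} = (\<Union>n::nat. {y. \<exists>x. x \<in> cball 0 (real n) \<and> (x, y) \<in> T})"
    by blast
  moreover have "closed {y. \<exists>x. x \<in> cball 0 (real n) \<and> (x, y) \<in> T}" for n
    by (rule closed_compact_projection) (use assms in auto)
  ultimately show ?thesis by auto
qed

text \<open>The set is the projection of a closed set, hence a countable union of closed sets.\<close>

lemma borel_gaps:
  fixes U :: "'a::euclidean_space set" and f :: "'a ^ 'v::finite \<Rightarrow> 'a"
  assumes "subspace U" "continuous_on UNIV f"
  shows "{Q :: 'a ^ 'v. f Q \<in> gaps U (($) Q) u H h h'} \<in> sets borel"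
proof -
  define T :: "((('a ^ 'v) \<times> ('a ^ ('v set)) \<times> ((real ^ 'v) ^ ('v set))) \<times> ('a ^ 'v)) set" where
    "T = {z. f (snd z) = fst (snd (fst z)) $ h - fst (snd (fst z)) $ h'} \<inter>
      (\<Inter>k\<in>H. (\<lambda>z. fst (snd (fst z)) $ k) -` U \<inter>
        (\<Inter>v\<in>k - {u}. {z. fst (fst z) $ v - fst (snd (fst z)) $ k =
          (snd (snd (fst z)) $ k $ v) *\<^sub>R (snd z $ v)}))"
  have "closed U" using assms(1) by (rule closed_subspace)
  then have "closed T" unfolding T_def
    using assms(2)
    by (intro closed_Int closed_INT ballI closed_Collect_eq closed_vimage continuous_intros
        continuous_on_compose2[OF assms(2)]) auto
  then have "{Q. \<exists>p. (p, Q) \<in> T} \<in> sets borel" by (rule borel_projection)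
  moreover have "(\<exists>p. (p, Q) \<in> T) \<longleftrightarrow> f Q \<in> gaps U (($) Q) u H h h'" for Q
  proof
    assume "\<exists>p. (p, Q) \<in> T"
    then obtain m w t where "((m, w, t), Q) \<in> T" by (metis prod_cases3)
    then show "f Q \<in> gaps U (($) Q) u H h h'"
      unfolding gaps_def T_def
      by (intro CollectI exI[of _ "($) m"] exI[of _ "($) w"]) (auto simp: span_singleton)
  next
    assume "f Q \<in> gaps U (($) Q) u H h h'"
    then obtain m w where fQ: "f Q = w h - w h'"
      and w: "\<And>k. k \<in> H \<Longrightarrow> w k \<in> U"
      and "\<And>k v. k \<in> H \<Longrightarrow> v \<in> k - {u} \<Longrightarrow> m v - w k \<in> span {Q $ v}"
      unfolding gaps_def by blast
    then have "\<forall>k v. \<exists>a. k \<in> H \<longrightarrow> v \<in> k - {u} \<longrightarrow> m v - w k = a *\<^sub>R (Q $ v)"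
      by (force simp: span_singleton)
    then obtain t where "\<And>k v. k \<in> H \<Longrightarrow> v \<in> k - {u} \<Longrightarrow> m v - w k = t k v *\<^sub>R (Q $ v)" by metis
    then have "(((\<chi> v. m v), (\<chi> k. w k), (\<chi> k. \<chi> v. t k v)), Q) \<in> T"
      using fQ w by (auto simp: T_def)
    then show "\<exists>p. (p, Q) \<in> T" by blast
  qed
  ultimately show ?thesis by simp
qed

lemma borel_not_generic:
  fixes U :: "'a::euclidean_space set"
  assumes "subspace U"
  shows "{Q :: 'a ^ 'v::finite. Q $ u \<in> gaps U (($) Q) u H h h' \<and> \<not> U \<subseteq> gaps U (($) Q) u H h h'} \<in> sets borel"
proof -
  obtain B where B: "B \<subseteq> U" "finite B" "span B = U"
    using orthonormal_basis_subspace[OF assms] finiteI_independent by metis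
  have "U \<subseteq> gaps U (($) Q) u H h h' \<longleftrightarrow> (\<forall>b\<in>B. b \<in> gaps U (($) Q) u H h h')" for Q :: "'a ^ 'v"
    using B span_minimal[OF _ subspace_gaps[OF assms], of B "($) Q" u H h h'] by blast
  then have "{Q :: 'a ^ 'v. Q $ u \<in> gaps U (($) Q) u H h h' \<and> \<not> U \<subseteq> gaps U (($) Q) u H h h'} =
      {Q. Q $ u \<in> gaps U (($) Q) u H h h'} - (\<Inter>b\<in>B. {Q. b \<in> gaps U (($) Q) u H h h'})"
    by auto
  moreover have "{Q :: 'a ^ 'v. Q $ u \<in> gaps U (($) Q) u H h h'} \<in> sets borel"
    by (rule borel_gaps[OF assms]) (intro continuous_intros)
  moreover have "(\<Inter>b\<in>B. {Q :: 'a ^ 'v. b \<in> gaps U (($) Q) u H h h'}) \<in> sets borel"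
  proof -
    have 1: "{Q :: 'a ^ 'v. b \<in> gaps U (($) Q) u H h h'} \<in> sets borel" for b
      by (rule borel_gaps[OF assms]) (intro continuous_intros)
    have "(\<Inter>b\<in>B. {Q :: 'a ^ 'v. b \<in> gaps U (($) Q) u H h h'}) = {Q\<in>space borel. \<forall>b\<in>B. b \<in> gaps U (($) Q) u H h h'}"
      by auto
    also have "\<dots> \<in> sets borel" using B(2) 1 by (intro sets.sets_Collect_finite_All) (auto simp: space_borel)
    finally show ?thesis .
  qed
  ultimately show ?thesis by auto
qed

lemma gaps_cong:
  assumes "\<And>v. v \<noteq> u \<Longrightarrow> q v = q' v"
  shows "gaps U q u H h h' = gaps U q' u H h h'"
  using assms unfolding gaps_def by (metis (no_types, lifting) Diff_iff insertCI)

lemma measurable_rod_directions: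
  fixes R :: "'v::finite set"
  shows "(\<lambda>x. \<chi> v. rod_directions d R x v) \<in>
    borel_measurable (\<Pi>\<^sub>M j\<in>R \<times> {..<d - 1}. (lborel :: (real, 'n::{finite,linorder}) vec measure))"
    (is "_ \<in> borel_measurable ?M")
proof -
  have "(\<lambda>x. axis v (rod_directions d R x v)) \<in> borel_measurable ?M" for v
  proof (cases "v \<in> R")
    case True
    have "(\<lambda>x. wedge_list (map (\<lambda>i. x (v, i)) [0..<d - 1])) \<in> borel_measurable ?M"
      using True by (intro measurable_wedge_list[of "[0..<d - 1]" "\<lambda>i x. x (v, i)"]) auto
    moreover have "linear (\<lambda>s. axis v (ext_star s) :: 'n ext ^ 'v)"
      using linear_compose[OF linear_ext_star linear_axis] by (simp add: comp_def)
    then have "continuous_on UNIV (\<lambda>s. axis v (ext_star s) :: 'n ext ^ 'v)"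
      by (simp add: linear_continuous_on linear_conv_bounded_linear)
    ultimately have "(\<lambda>x. axis v (ext_star (wedge_list (map (\<lambda>i. x (v, i)) [0..<d - 1]))) :: 'n ext ^ 'v) \<in> borel_measurable ?M"
      by (rule borel_measurable_continuous_on[rotated])
    then show ?thesis using True by (simp add: rod_directions_def)
  qed (simp add: rod_directions_def)
  then have "(\<lambda>x. \<Sum>v\<in>UNIV. axis v (rod_directions d R x v)) \<in> borel_measurable ?M"
    by (intro borel_measurable_sum)
  moreover have "(\<Sum>v\<in>UNIV. axis v (rod_directions d R x v)) = (\<chi> v. rod_directions d R x v)"
    for x :: "'v \<times> nat \<Rightarrow> (real, 'n) vec"
    by (simp add: vec_eq_iff axis_def)
  ultimately show ?thesis by simp
qed


lemma ext_star_wedge_list_detects: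
  fixes z :: "('n::{finite,linorder}) ext"
  assumes "p \<in> ext_power 2" "z \<bullet> p \<noteq> 0"
  shows "\<exists>ys. length ys = CARD('n) - 2 \<and> z \<bullet> ext_star (wedge_list ys) \<noteq> 0"
proof -
  obtain S where S: "z $ S * p $ S \<noteq> 0"
    using assms(2) unfolding inner_vec_def by (metis (mono_tags, lifting) inner_real_def sum.neutral)
  then have S2: "card S = 2" using assms(1) by (auto simp: ext_power_def)
  obtain js where js: "set js = UNIV - S" "distinct js" using finite_distinct_list[of "UNIV - S"] by auto
  obtain c where c: "c \<noteq> 0" "wedge_list (map (\<lambda>i. axis i 1) js) = axis (UNIV - S) c"
    using wedge_list_axis[OF js(2)] js(1) by auto
  have "ext_star (axis (UNIV - S) c) = axis S (shuffle_sign S (UNIV - S) * c)"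
    using S2 by (auto simp: ext_star_def axis_def vec_eq_iff)
  then have "z \<bullet> ext_star (wedge_list (map (\<lambda>i. axis i 1) js)) \<noteq> 0"
    using c S shuffle_sign_nonzero[of S "UNIV - S"] by (simp add: inner_axis)
  moreover have "length js = CARD('n) - 2"
    using js S2 distinct_card[OF js(2)] card_Diff_subset[of S UNIV] by simp
  ultimately show ?thesis by (intro exI[of _ "map (\<lambda>i. axis i 1) js"]) simp
qed

text \<open>Fubini: once the rods other than \<open>u\<close> are fixed, the gaps are a fixed subspace, and if it is
  proper, then the rod of \<open>u\<close> avoids it almost surely.\<close>

lemma AE_generic_rod:
  fixes R :: "'v::finite set" and H :: "'v set set" and h h' :: "'v set"
  assumes d: "d + 1 = CARD('n::{finite,linorder})" and u: "u \<in> R"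
  defines "M \<equiv> \<lambda>K. \<Pi>\<^sub>M j\<in>K. (lborel :: (real, 'n) vec measure)"
  defines "G \<equiv> \<lambda>x. gaps (ext_power 2) (rod_directions d R x) u H h h'"
  shows "AE x in M (R \<times> {..<d - 1}). rod_directions d R x u \<in> G x \<longrightarrow> ext_power 2 \<subseteq> G x"
proof -
  interpret product_sigma_finite "\<lambda>_. lborel :: (real, 'n) vec measure" by standard
  let ?I = "(R - {u}) \<times> {..<d - 1}" and ?J = "{u} \<times> {..<d - 1}"
  let ?U = "ext_power 2 :: 'n ext set"
  let ?bad = "{x. \<not> (rod_directions d R x u \<in> G x \<longrightarrow> ?U \<subseteq> G x)}"
  have IJ: "?I \<inter> ?J = {}" "?I \<union> ?J = R \<times> {..<d - 1}" using u by auto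
  have "{x \<in> space (M (R \<times> {..<d - 1})). (\<chi> v. rod_directions d R x v) \<in>
      {Q :: 'n ext ^ 'v. Q $ u \<in> gaps ?U (($) Q) u H h h' \<and> \<not> ?U \<subseteq> gaps ?U (($) Q) u H h h'}} \<in> sets (M (R \<times> {..<d - 1}))"
    unfolding M_def
    using measurable_sets[OF measurable_rod_directions borel_not_generic[OF subspace_ext_power]]
    by (simp add: vimage_def Int_def conj_commute)
  moreover have eta: "($) (\<chi> v. rod_directions d R x v) = rod_directions d R x" for x :: "'v \<times> nat \<Rightarrow> (real, 'n) vec"
    by (simp add: fun_eq_iff)
  ultimately have bad_sets: "{x \<in> space (M (R \<times> {..<d - 1})). x \<in> ?bad} \<in> sets (M (R \<times> {..<d - 1}))"
    by (simp add: G_def)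
  have "indicator ?bad \<in> borel_measurable (M (?I \<union> ?J))"
    unfolding IJ(2) using borel_measurable_indicator'[of _ "\<lambda>x. x", OF bad_sets] by simp
  then have "integral\<^sup>N (M (R \<times> {..<d - 1})) (indicator ?bad) =
      (\<integral>\<^sup>+x. (\<integral>\<^sup>+y. indicator ?bad (merge ?I ?J (x, y)) \<partial>M ?J) \<partial>M ?I)"
    unfolding M_def IJ(2)[symmetric]
    by (intro product_nn_integral_fold[OF IJ(1)]) auto
  also have "\<dots> = (\<integral>\<^sup>+x. 0 \<partial>M ?I)"
  proof (rule nn_integral_cong)
    fix x
    define W where "W = G (merge ?I ?J (x, \<lambda>_. undefined))"
    have GW: "G (merge ?I ?J (x, y)) = W" for y
      unfolding W_def G_def
    proof (rule gaps_cong)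
      fix v assume "v \<noteq> u"
      then show "rod_directions d R (merge ?I ?J (x, y)) v =
          rod_directions d R (merge ?I ?J (x, \<lambda>_. undefined)) v"
        by (auto simp: rod_directions_def merge_def intro!: arg_cong[of _ _ ext_star] arg_cong[of _ _ wedge_list])
    qed
    have dir: "rod_directions d R (merge ?I ?J (x, y)) u = ext_star (wedge_list (map y (map (Pair u) [0..<d - 1])))" for y
      using u by (auto simp: rod_directions_def merge_def intro!: arg_cong[of _ _ ext_star] arg_cong[of _ _ wedge_list])
    have "AE y in M ?J. indicator ?bad (merge ?I ?J (x, y)) = (0::ennreal)"
    proof (cases "?U \<subseteq> W")
      case True
      then have "merge ?I ?J (x, y) \<notin> ?bad" for y unfolding mem_Collect_eq GW by blast
      then show ?thesis by (intro AE_I2 indicator_simps(2))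
    next
      case False
      then obtain p where p: "p \<in> ?U" "p \<notin> W" by blast
      have subW: "subspace W" unfolding W_def G_def by (rule subspace_gaps[OF subspace_ext_power])
      obtain y z where y: "y \<in> span W" and z: "\<And>w. w \<in> span W \<Longrightarrow> orthogonal z w" and pyz: "p = y + z"
        using orthogonal_subspace_decomp_exists[of W p] by blast
      have "y \<in> W" using y subW by (simp add: span_eq_iff[THEN iffD2])
      then have "z \<noteq> 0" using p pyz by auto
      moreover have "z \<bullet> y = 0" using z[OF y] by (simp add: orthogonal_def)
      ultimately have "z \<bullet> p \<noteq> 0" by (simp add: pyz inner_add_right)
      from ext_star_wedge_list_detects[OF p(1) this] obtain ys
        where ys: "length ys = CARD('n) - 2" "z \<bullet> ext_star (wedge_list ys) \<noteq> 0" by blast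
      have lin: "linear (\<lambda>s. z \<bullet> ext_star s)"
        using linear_compose[OF linear_ext_star, of "(\<bullet>) z"] by (simp add: comp_def linear_conv_bounded_linear bounded_linear_inner_right)
      have J: "?J = set (map (Pair u) [0..<d - 1])" by (auto simp: image_iff)
      have "AE y in M ?J. z \<bullet> ext_star (wedge_list (map y (map (Pair u) [0..<d - 1]))) \<noteq> 0"
        unfolding M_def J
        by (rule AE_wedge_list_nonzero[OF _ lin _ ys(2)])
          (use d ys(1) in \<open>auto simp: distinct_map inj_on_def\<close>)
      then show ?thesis
      proof eventually_elim
        case (elim y')
        have "rod_directions d R (merge ?I ?J (x, y')) u \<notin> W"
        proof
          assume "rod_directions d R (merge ?I ?J (x, y')) u \<in> W"
          then have "orthogonal z (rod_directions d R (merge ?I ?J (x, y')) u)" by (intro z span_base)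
          then show False using elim unfolding dir orthogonal_def by contradiction
        qed
        then have "merge ?I ?J (x, y') \<notin> ?bad" unfolding mem_Collect_eq GW by blast
        then show ?case by (rule indicator_simps(2))
      qed
    qed
    then have "(\<integral>\<^sup>+y. indicator ?bad (merge ?I ?J (x, y)) \<partial>M ?J) = (\<integral>\<^sup>+y. 0 \<partial>M ?J)"
      by (rule nn_integral_cong_AE)
    then show "(\<integral>\<^sup>+y. indicator ?bad (merge ?I ?J (x, y)) \<partial>M ?J) = 0" by simp
  qed
  finally have "integral\<^sup>N (M (R \<times> {..<d - 1})) (indicator ?bad) = 0" by simp
  moreover have "{x \<in> space (M (R \<times> {..<d - 1})). rod_directions d R x u \<in> G x \<longrightarrow> ?U \<subseteq> G x} \<in> sets (M (R \<times> {..<d - 1}))"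
    using sets.sets_Collect_neg[OF bad_sets] by simp
  ultimately show ?thesis by (subst AE_iff_nn_integral) auto
qed

section \<open>Flats of a rod-configuration\<close>

lemma dim_ext_power_2_ge:
  assumes "3 \<le> d" "CARD('n::{finite,linorder}) = d + 1"
  shows "4 \<le> dim (ext_power 2 :: 'n ext set)"
proof -
  have "(4::nat) choose 2 \<le> (d + 1) choose 2" using assms by (intro binomial_right_mono) simp
  moreover have "(4::nat) choose 2 = 6" by (simp add: numeral_eq_Suc)
  ultimately show ?thesis by (simp add: dim_ext_power assms(2))
qed

lemma AE_generic_directions:
  fixes R :: "'v::finite set"
  assumes d: "3 \<le> d" "CARD('n::{finite,linorder}) = d + 1"
  shows "AE x in (\<Pi>\<^sub>M j\<in>R \<times> {..<d - 1}. (lborel :: (real, 'n) vec measure)).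
    generic_directions (ext_power 2) R (rod_directions d R x)"
proof -
  let ?U = "ext_power 2 :: 'n ext set"
  have "AE x in (\<Pi>\<^sub>M j\<in>R \<times> {..<d - 1}. (lborel :: (real, 'n) vec measure)).
    \<forall>u\<in>R. \<forall>H\<in>UNIV. \<forall>h\<in>UNIV. \<forall>h'\<in>UNIV.
      rod_directions d R x u \<in> gaps ?U (rod_directions d R x) u H h h' \<longrightarrow>
      ?U \<subseteq> gaps ?U (rod_directions d R x) u H h h'"
    using d by (intro AE_finite_allI AE_generic_rod) auto
  then show ?thesis
  proof eventually_elim
    case (elim x)
    show ?case
    proof
      show "subspace ?U" by (rule subspace_ext_power)
      show "rod_directions d R x v \<in> ?U" for v
        by (simp add: rod_directions_def ext_star_in_ext_power subspace_0 subspace_ext_power)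
      show "rod_directions d R x v = 0" if "v \<notin> R" for v using that by (simp add: rod_directions_def)
      show "4 \<le> dim ?U" using dim_ext_power_2_ge[OF d] .
    qed (use elim in blast)
  qed
qed

lemma flat_rank_proj_span: "flat_rank (proj_span X) = dim (span (\<Union>X))"
proof -
  have "flat_subspace (proj_span X) = span (\<Union>X)"
  proof
    have "span {p} \<subseteq> span (\<Union>X)" if "p \<in> span (\<Union>X)" for p
      using that by (intro span_minimal) auto
    then show "flat_subspace (proj_span X) \<subseteq> span (\<Union>X)"
      by (auto simp: flat_subspace_def proj_span_def proj_space_def proj_point_def span_0)
    show "span (\<Union>X) \<subseteq> flat_subspace (proj_span X)"
      by (auto simp: flat_subspace_def proj_span_def proj_space_def proj_point_def intro: span_base)
  qed
  then show ?thesis by (simp add: flat_rank_def)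
qed

lemma proj_point_eqD:
  assumes "proj_point a = proj_point b"
  shows "\<exists>c. a = c *\<^sub>R b"
proof -
  have "a \<in> proj_point b" using assms by (metis insertI1 proj_point_def span_base)
  then show ?thesis by (auto simp: proj_point_def span_singleton)
qed

lemma proj_point_in_rod_hyperplane:
  fixes a :: "('n::{finite,linorder}) ext"
  shows "proj_point a \<in> rod_hyperplane R (spanned_rods d R x) v \<longleftrightarrow>
    a \<in> ext_power 2 \<and> a \<noteq> 0 \<and> a \<bullet> rod_directions d R x v = 0"
proof -
  have U: "subspace (ext_power 2 :: 'n ext set)" by (rule subspace_ext_power)
  have scale: "a \<in> ext_power 2 \<and> a \<noteq> 0" if p: "proj_point a = proj_point p" "p \<in> ext_power 2" "p \<noteq> 0" for p :: "'n ext"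
  proof -
    obtain c where c: "a = c *\<^sub>R p" using proj_point_eqD[OF p(1)] by blast
    obtain c' where "p = c' *\<^sub>R a" using proj_point_eqD[OF p(1)[symmetric]] by blast
    then show ?thesis using c p U by (auto simp: subspace_scale)
  qed
  show ?thesis
  proof (cases "v \<in> R")
    case True
    let ?s = "wedge_list (map (\<lambda>i. x (v, i)) [0..<d - 1])"
    have rods: "spanned_rods d R x v = span {?s}" using True by (simp add: spanned_rods_def proj_point_def)
    have dir: "rod_directions d R x v = ext_star ?s" using True by (simp add: rod_directions_def)
    have "(\<forall>s\<in>span {?s}. ext_pairing p s = 0) \<longleftrightarrow> p \<bullet> ext_star ?s = 0" if "p \<in> ext_power 2" for p
    proof -
      have "ext_pairing p (c *\<^sub>R ?s) = c * (p \<bullet> ext_star ?s)" for c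
        unfolding ext_pairing_eq_inner_ext_star[OF that] linear_scale[OF linear_ext_star] by simp
      then have "(\<forall>s\<in>span {?s}. ext_pairing p s = 0) \<longleftrightarrow> (\<forall>c. c * (p \<bullet> ext_star ?s) = 0)"
        unfolding span_singleton by auto
      then show ?thesis by (metis mult_1 mult_zero_right)
    qed
    then have hyp: "rod_hyperplane R (spanned_rods d R x) v =
        {proj_point p | p. p \<in> ext_power 2 - {0} \<and> p \<bullet> ext_star ?s = 0}"
      unfolding rod_hyperplane_def rods using True by (simp only: if_True) blast
    show ?thesis
    proof
      assume "proj_point a \<in> rod_hyperplane R (spanned_rods d R x) v"
      then obtain p where p: "proj_point a = proj_point p" "p \<in> ext_power 2" "p \<noteq> 0"
        "p \<bullet> ext_star ?s = 0"
        unfolding hyp by blast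
      moreover obtain c where "a = c *\<^sub>R p" using proj_point_eqD[OF p(1)] by blast
      ultimately show "a \<in> ext_power 2 \<and> a \<noteq> 0 \<and> a \<bullet> rod_directions d R x v = 0"
        using scale[OF p(1-3)] unfolding dir by simp
    next
      assume "a \<in> ext_power 2 \<and> a \<noteq> 0 \<and> a \<bullet> rod_directions d R x v = 0"
      then show "proj_point a \<in> rod_hyperplane R (spanned_rods d R x) v"
        unfolding hyp dir by blast
    qed
  next
    case False
    then show ?thesis
      using scale by (auto simp: rod_hyperplane_def rod_directions_def proj_space_def)
  qed
qed

lemma span_edge_flats:
  fixes x :: "'v::finite \<times> nat \<Rightarrow> (real, 'n::{finite,linorder}) vec"
  assumes gen: "generic_directions (ext_power 2) R (rod_directions d R x)"
    and ends: "\<And>e. e \<in> F \<Longrightarrow> card (ends e) = 2"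
  shows "span (\<Union>(\<Union>(edge_flats R ends (spanned_rods d R x) F))) =
    generic_directions.stress_span (ext_power 2) (rod_directions d R x) (ends ` F)"
proof -
  interpret generic_directions "ext_power 2" R "rod_directions d R x" by (rule gen)
  let ?r = "spanned_rods d R x"
  let ?X = "\<Union>(\<Union>(edge_flats R ends ?r F))"
  have sum2: "(\<Sum>w\<in>UNIV. if w = u then a else if w = v then b else 0) = a + b"
    if "u \<noteq> v" for u v :: 'v and a b :: "'n ext"
  proof -
    have "(\<Sum>w\<in>UNIV. if w = u then a else if w = v then b else 0) =
        (\<Sum>w\<in>UNIV. (if w = u then a else 0) + (if w = v then b else 0))"
      using that by (intro sum.cong) auto
    then show ?thesis by (simp add: sum.distrib)
  qed
  show ?thesis
  proof
    have "?X \<subseteq> stress_span (ends ` F)"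
    proof
      fix y assume "y \<in> ?X"
      then obtain e where e: "e \<in> F" "y \<in> \<Union>(edge_flat R ends ?r e)" by (auto simp: edge_flats_def)
      then obtain u v a where y: "y \<in> proj_point (\<chi> w. if w = u then a else if w = v then - a else 0)"
        and uv: "ends e = {u, v}" "u \<noteq> v"
        and a: "proj_point a \<in> rod_hyperplane R ?r u" "proj_point a \<in> rod_hyperplane R ?r v"
        by (auto simp: edge_flat_def)
      let ?p = "\<chi> w. if w = u then a else if w = v then - a else 0"
      have "?p \<in> stresses (ends e)"
        using a uv sum2[OF uv(2), of a "- a"]
        by (auto simp: proj_point_in_rod_hyperplane stresses_def blocks_def
            subspace_ext_power subspace_neg subspace_0)
      then have "?p \<in> stress_span (ends ` F)" unfolding stress_span_def using e(1) by (auto intro: span_base)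
      then have "span {?p} \<subseteq> stress_span (ends ` F)"
        by (intro span_minimal) (auto simp: stress_span_def)
      then show "y \<in> stress_span (ends ` F)" using y unfolding proj_point_def by blast
    qed
    then show "span ?X \<subseteq> stress_span (ends ` F)"
      unfolding stress_span_def by (rule span_minimal) simp
    have "stresses (ends e) \<subseteq> span ?X" if e: "e \<in> F" for e
    proof
      fix y assume y: "y \<in> stresses (ends e)"
      show "y \<in> span ?X"
      proof (cases "y = 0")
        case False
        obtain u v where uv: "ends e = {u, v}" "u \<noteq> v" using ends[OF e] by (metis card_2_iff)
        have "(\<Sum>w\<in>UNIV. y $ w) = (\<Sum>w\<in>UNIV. if w = u then y $ u else if w = v then y $ v else 0)"
          using y uv by (intro sum.cong) (auto simp: stresses_def)
        then have v: "y $ v = - y $ u"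
          using y sum2[OF uv(2)] by (simp add: stresses_def add_eq_0_iff)
        define a where "a = y $ u"
        have eq: "y = (\<chi> w. if w = u then a else if w = v then - a else 0)"
          using y uv v by (auto simp: stresses_def vec_eq_iff a_def)
        have "a \<noteq> 0" using False eq by (auto simp: vec_eq_iff split: if_splits)
        moreover have "a \<in> ext_power 2" "a \<bullet> rod_directions d R x u = 0"
          using y by (auto simp: stresses_def blocks_def a_def)
        moreover have "- a \<bullet> rod_directions d R x v = 0"
          using y v unfolding stresses_def a_def by (metis (mono_tags, lifting) mem_Collect_eq)
        ultimately have "proj_point a \<in> rod_hyperplane R ?r u \<inter> rod_hyperplane R ?r v"
          by (simp add: proj_point_in_rod_hyperplane)
        then have "proj_point y \<in> edge_flat R ends ?r e"
          unfolding edge_flat_def eq using uv by blast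
        moreover have "y \<in> proj_point y" by (simp add: proj_point_def span_base)
        ultimately have "y \<in> ?X" using e by (auto simp: edge_flats_def)
        then show ?thesis by (rule span_base)
      qed (simp add: span_0)
    qed
    then show "stress_span (ends ` F) \<subseteq> span ?X"
      unfolding stress_span_def by (intro span_minimal) auto
  qed
qed

theorem theorem4p11:
  fixes d D :: nat
    and V B R :: "'v::finite set"
    and E :: "'e set"
    and ends :: "'e \<Rightarrow> 'v set"
  assumes "d \<ge> 3"
    and "CARD('n::{finite,linorder}) = d + 1"
    and "D = (d + 1) choose 2"
    and "multigraph V E ends"
    and "B \<union> R = V" and "B \<inter> R = {}"
  shows "almost_all_rod_configurations d R
           (\<lambda>r :: 'v \<Rightarrow> 'n ext set.
              int (flat_rank (proj_span (\<Union>(edge_flats R ends r E)))) =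
                Min {(\<Sum>X\<in>P. int D * int (card (verts_of ends X)) - int D
                              - int (card (R \<inter> verts_of ends X))) | P. partition_on E P}
            \<and> (\<forall>F\<subseteq>E. int (flat_rank (proj_span (\<Union>(edge_flats R ends r F)))) =
                        count_f_hat d R ends F))"
  unfolding almost_all_rod_configurations_def
  using AE_generic_directions[OF assms(1,2), of R]
proof eventually_elim
  case (elim x)
  interpret generic_directions "ext_power 2" R "rod_directions d R x" by (rule elim)
  have dim2: "dim (ext_power 2 :: 'n ext set) = (d + 1) choose 2"
    by (simp add: dim_ext_power assms(2))
  have E: "finite E" "\<And>e. e \<in> E \<Longrightarrow> card (ends e) = 2"
    using assms(4) by (auto simp: multigraph_def)
  have sparsity: "sparsity (\<Union>(ends ` X)) = count_f d R ends X" for X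
    by (simp add: sparsity_def count_f_def verts_of_def dim2)
  have rank: "int (flat_rank (proj_span (\<Union>(edge_flats R ends (spanned_rods d R x) F)))) = count_f_hat d R ends F"
    if "F \<subseteq> E" for F
  proof -
    have "card (ends e) = 2" if "e \<in> F" for e using E(2) \<open>F \<subseteq> E\<close> that by blast
    then have "int (flat_rank (proj_span (\<Union>(edge_flats R ends (spanned_rods d R x) F)))) =
        int (dim (stress_span (ends ` F)))"
      using span_edge_flats[OF elim, of F ends] by (simp only: flat_rank_proj_span)
    also have "\<dots> = count_f_hat d R ends F"
      unfolding count_f_hat_def sparsity[symmetric]
      using \<open>F \<subseteq> E\<close> E by (intro dim_stress_span_eq_Min) (auto intro: finite_subset)
    finally show ?thesis .
  qed
  have "int D * int (card (verts_of ends X)) - int D - int (card (R \<inter> verts_of ends X)) = count_f d R ends X" for X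
    by (simp add: count_f_def assms(3) algebra_simps)
  then show ?case using rank by (simp add: count_f_hat_def)
qed

end
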